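(* Let $m,n\ge 1$ be integers, let $d\in\{\triangle,\delta\}$, and let $S\in B(\mathcal H)$ satisfy $S^{*n}\,d^m_{S^*,S}(I)\,S^n=0$. Let $P=P_1\oplus I_2$ be the operator on $\mathcal H=\overline{S^n(\mathcal H)}\oplus \ker(S^{*n})$ associated with $S$ and $n$ as in the context. (i) If $d=\triangle$, then there exist operators $Q,A\in B(\mathcal H)$ such that $Q\ge 0$, $\triangle^m_{A^*,A}(Q)=0$ and $S^n$ is similar to $A$. (ii) If $d=\delta$ and the operator $S$ is injective, then there exist operators $Q,A\in B(\mathcal H)$ such that $Q\ge 0$, $\delta^m_{A^*,A}(Q)=0$ and $\delta_{A,S^n}(P)=0$ (i.e. $AP=PS^n$). (iii) If $S$ is left invertible, then there exists an operator $B\in B(\mathcal H)$ such that $d^m_{B^*,B}(I)=0$ and $S^n$ is similar to $B$.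
   Context: $\mathcal H$ is a complex infinite dimensional Hilbert space and $B(\mathcal H)$ is the algebra of bounded linear operators on it. For $T,S\in B(\mathcal H)$ the maps $\triangle_{T,S},\delta_{T,S}$ on $B(\mathcal H)$ are $\triangle_{T,S}(X)=TXS-X$ and $\delta_{T,S}(X)=TX-XS$; $d$ denotes either $\triangle$ or $\delta$, and $d^m_{T,S}$ is the $m$-fold composition of $d_{T,S}$. Explicitly, $\triangle^m_{T,S}(X)=\sum_{j=0}^m(-1)^j\binom mj T^{m-j}XS^{m-j}$ and $\delta^m_{T,S}(X)=\sum_{j=0}^m(-1)^j\binom mj T^{m-j}XS^{j}$. Let $S_1=S|_{\overline{S^n(\mathcal H)}}$, let $S_1^n=U_1P_1$ be the polar decomposition of $S_1^n$ (so $P_1=(S_1^{*n}S_1^n)^{1/2}$), let $I_2$ be the identity on $\ker(S^{*n})$, and put $P=P_1\oplus I_2$ on $\overline{S^n(\mathcal H)}\oplus\ker(S^{*n})$. *)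

theory Defs
  imports "HOL-Analysis.Analysis"
begin

section \<open>Complex Hilbert spaces\<close>

text \<open>
  A complex Hilbert space carries a canonical real Hilbert space structure with inner product
  the real part of the complex one; norm, topology and completeness are inherited from it.
  The complex inner product is conjugate-linear in its first argument.
\<close>

class complex_hilbert_space = real_inner + banach +
  fixes scaleC :: "complex \<Rightarrow> 'a \<Rightarrow> 'a"  (infixr "*\<^sub>C" 75)
    and cinner :: "'a \<Rightarrow> 'a \<Rightarrow> complex"
  assumes scaleC_add_right: "a *\<^sub>C (x + y) = a *\<^sub>C x + a *\<^sub>C y"
    and scaleC_add_left: "(a + b) *\<^sub>C x = a *\<^sub>C x + b *\<^sub>C x"
    and scaleC_scaleC: "a *\<^sub>C b *\<^sub>C x = (a * b) *\<^sub>C x"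
    and scaleC_one: "1 *\<^sub>C x = x"
    and scaleR_scaleC: "r *\<^sub>R x = complex_of_real r *\<^sub>C x"
    and cinner_commute: "cinner x y = cnj (cinner y x)"
    and cinner_add_right: "cinner x (y + z) = cinner x y + cinner x z"
    and cinner_scaleC_right: "cinner x (a *\<^sub>C y) = a * cinner x y"
    and inner_Re_cinner: "inner x y = Re (cinner x y)"

interpretation complex_vector:
  vector_space "scaleC :: complex \<Rightarrow> 'a \<Rightarrow> 'a :: complex_hilbert_space"
  by unfold_locales
    (simp_all add: scaleC_add_right scaleC_add_left scaleC_scaleC scaleC_one)

definition infinite_dimensional :: "'a :: complex_hilbert_space itself \<Rightarrow> bool" where
  "infinite_dimensional _ \<longleftrightarrow> \<not> (\<exists>B :: 'a set. finite B \<and> complex_vector.span B = UNIV)"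

section \<open>Bounded operators\<close>

text \<open>
  The bounded linear operators on a subspace \<open>M\<close>. So that an operator on \<open>M\<close> is determined as a
  HOL function, it is given the value 0 outside \<open>M\<close>. Operators on the whole space are those on
  \<open>UNIV\<close>, where this convention is void.
\<close>

definition bounded_operators :: "'a :: complex_hilbert_space set \<Rightarrow> ('a \<Rightarrow> 'a) set" where
  "bounded_operators M = {T. (\<forall>x\<in>M. T x \<in> M) \<and>
     (\<forall>x\<in>M. \<forall>y\<in>M. T (x + y) = T x + T y) \<and>
     (\<forall>c. \<forall>x\<in>M. T (c *\<^sub>C x) = c *\<^sub>C T x) \<and>
     (\<exists>K. \<forall>x\<in>M. norm (T x) \<le> K * norm x) \<and>
     (\<forall>x. x \<notin> M \<longrightarrow> T x = 0)}"

abbreviation BH :: "('a :: complex_hilbert_space \<Rightarrow> 'a) set" where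
  "BH \<equiv> bounded_operators UNIV"

lemma BH_iff:
  "T \<in> BH \<longleftrightarrow> bounded_linear T \<and> (\<forall>c x. T (c *\<^sub>C x) = c *\<^sub>C T x)"
proof
  assume T: "T \<in> BH"
  then obtain K where "\<And>x. norm (T x) \<le> K * norm x"
    by (auto simp: bounded_operators_def)
  with T have "bounded_linear T"
    by (intro bounded_linear_intro[where K = K])
      (auto simp: bounded_operators_def scaleR_scaleC mult.commute)
  with T show "bounded_linear T \<and> (\<forall>c x. T (c *\<^sub>C x) = c *\<^sub>C T x)"
    by (auto simp: bounded_operators_def)
next
  assume T: "bounded_linear T \<and> (\<forall>c x. T (c *\<^sub>C x) = c *\<^sub>C T x)"
  then obtain K where "\<And>x. norm (T x) \<le> norm x * K"
    using bounded_linear.bounded by blast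
  then show "T \<in> BH"
    using T by (auto simp: bounded_operators_def linear_simps mult.commute)
qed

text \<open>The operators \<open>adjoint_on\<close> and \<open>sqrt_on\<close> below are meant for closed subspaces \<open>M\<close>.\<close>

definition adjoint_on ::
  "'a :: complex_hilbert_space set \<Rightarrow> ('a \<Rightarrow> 'a) \<Rightarrow> ('a \<Rightarrow> 'a)" where
  "adjoint_on M T = (THE T'. T' \<in> bounded_operators M \<and>
     (\<forall>x\<in>M. \<forall>y\<in>M. cinner (T x) y = cinner x (T' y)))"

abbreviation adj :: "('a :: complex_hilbert_space \<Rightarrow> 'a) \<Rightarrow> ('a \<Rightarrow> 'a)" where
  "adj \<equiv> adjoint_on UNIV"

definition positive_on :: "'a :: complex_hilbert_space set \<Rightarrow> ('a \<Rightarrow> 'a) \<Rightarrow> bool" where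
  "positive_on M Q \<longleftrightarrow> Q \<in> bounded_operators M \<and> (\<forall>x\<in>M. cinner x (Q x) \<in> \<real>\<^sub>\<ge>\<^sub>0)"

definition sqrt_on ::
  "'a :: complex_hilbert_space set \<Rightarrow> ('a \<Rightarrow> 'a) \<Rightarrow> ('a \<Rightarrow> 'a)" where
  "sqrt_on M T = (THE R. positive_on M R \<and> R \<circ> R = T)"

definition restrict_op ::
  "('a :: complex_hilbert_space \<Rightarrow> 'a) \<Rightarrow> 'a set \<Rightarrow> ('a \<Rightarrow> 'a)" where
  "restrict_op T M = (\<lambda>x. if x \<in> M then T x else 0)"

text \<open>\<open>A \<oplus> B\<close> on the space decomposed as the direct sum of \<open>M\<close> and \<open>N\<close>:\<close>

definition direct_sum_op ::
  "'a :: complex_hilbert_space set \<Rightarrow> ('a \<Rightarrow> 'a) \<Rightarrow> 'a set \<Rightarrow> ('a \<Rightarrow> 'a) \<Rightarrow> ('a \<Rightarrow> 'a)" where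
  "direct_sum_op M A N B = (\<lambda>x. THE z. \<exists>u\<in>M. \<exists>v\<in>N. x = u + v \<and> z = A u + B v)"

definition left_invertible :: "('a :: complex_hilbert_space \<Rightarrow> 'a) \<Rightarrow> bool" where
  "left_invertible S \<longleftrightarrow> (\<exists>L\<in>BH. L \<circ> S = id)"

definition similar :: "('a :: complex_hilbert_space \<Rightarrow> 'a) \<Rightarrow> ('a \<Rightarrow> 'a) \<Rightarrow> bool" where
  "similar S A \<longleftrightarrow>
     (\<exists>V\<in>BH. \<exists>W\<in>BH. V \<circ> W = id \<and> W \<circ> V = id \<and> V \<circ> S = A \<circ> V)"

section \<open>The maps \<open>\<triangle>\<close> and \<open>\<delta>\<close>, and the operator \<open>P\<close>\<close>

definition elem_tri ::
  "('a :: complex_hilbert_space \<Rightarrow> 'a) \<Rightarrow> ('a \<Rightarrow> 'a) \<Rightarrow> ('a \<Rightarrow> 'a) \<Rightarrow> ('a \<Rightarrow> 'a)" where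
  "elem_tri T S X = (\<lambda>x. T (X (S x)) - X x)"

definition elem_delta ::
  "('a :: complex_hilbert_space \<Rightarrow> 'a) \<Rightarrow> ('a \<Rightarrow> 'a) \<Rightarrow> ('a \<Rightarrow> 'a) \<Rightarrow> ('a \<Rightarrow> 'a)" where
  "elem_delta T S X = (\<lambda>x. T (X x) - X (S x))"

definition range_closure ::
  "nat \<Rightarrow> ('a :: complex_hilbert_space \<Rightarrow> 'a) \<Rightarrow> 'a set" where
  "range_closure n S = closure (range (S ^^ n))"

definition adj_kernel ::
  "nat \<Rightarrow> ('a :: complex_hilbert_space \<Rightarrow> 'a) \<Rightarrow> 'a set" where
  "adj_kernel n S = {x. (adj S ^^ n) x = 0}"

text \<open>
  \<open>P\<^sub>1\<close> is the positive factor of the polar decomposition of \<open>S\<^sub>1\<^sup>n\<close>, where \<open>S\<^sub>1\<close> is \<open>S\<close> restricted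
  to the closure of the range of \<open>S\<^sup>n\<close>; the adjoint is taken in that subspace. With the value 0
  outside the subspace, powers and products of operators on it are plain iterates and
  compositions, for exponents at least 1.
\<close>

definition polar_part ::
  "nat \<Rightarrow> ('a :: complex_hilbert_space \<Rightarrow> 'a) \<Rightarrow> ('a \<Rightarrow> 'a)" where
  "polar_part n S =
     (let M = range_closure n S; S\<^sub>1 = restrict_op S M
      in sqrt_on M ((adjoint_on M S\<^sub>1 ^^ n) \<circ> (S\<^sub>1 ^^ n)))"

definition polar_sum ::
  "nat \<Rightarrow> ('a :: complex_hilbert_space \<Rightarrow> 'a) \<Rightarrow> ('a \<Rightarrow> 'a)" where
  "polar_sum n S =
     direct_sum_op (range_closure n S) (polar_part n S)
       (adj_kernel n S) (restrict_op id (adj_kernel n S))"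

end

theory Submission
  imports Defs
begin

text \<open>
  Write \<open>G = S\<^sup>*\<^sup>n S\<^sup>n\<close>. Multiplication by \<open>S\<^sup>*\<^sup>n\<close> from the left and \<open>S\<^sup>n\<close> from the right commutes with
  the map \<open>d\<close> for the pair \<open>(S\<^sup>*, S)\<close>, so the hypothesis says that \<open>d\<^sup>m\<close> kills \<open>G\<close>. In the
  commutative algebra of left and right multiplications, \<open>d\<close> for the pair \<open>(S\<^sup>*\<^sup>n, S\<^sup>n)\<close> is a
  multiple of \<open>d\<close> for \<open>(S\<^sup>*, S)\<close>, so \<open>d\<^sup>m\<close> for that pair kills \<open>G\<close> as well
  (\<open>elem_power_of_powers\<close>). Now let \<open>P\<close> be self-adjoint and injective with \<open>A P = P S\<^sup>n\<close> and
  \<open>P Q P = G\<close>. Then \<open>d\<^sup>m\<close> for \<open>(S\<^sup>*\<^sup>n, S\<^sup>n)\<close> at \<open>G\<close> is \<open>P Y P\<close>, where \<open>Y\<close> is \<open>d\<^sup>m\<close> for \<open>(A\<^sup>*, A)\<close> at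
  \<open>Q\<close>; cancelling \<open>P\<close> gives \<open>Y = 0\<close> (\<open>transported_defect_zero\<close>). The three parts are three choices of
  \<open>P\<close>, \<open>Q\<close> and \<open>A\<close>.

  For (i) take \<open>P = I\<close>, \<open>Q = G\<close> and \<open>A = S\<^sup>n\<close>.

  For (ii) \<open>P\<close> is prescribed. With \<open>\<pi>\<close> the projection onto the closure of the range of \<open>S\<^sup>n\<close>,
  \<open>P\<close> satisfies \<open>\<parallel>P x\<parallel>\<^sup>2 = \<parallel>S\<^sup>n \<pi> x\<parallel>\<^sup>2 + \<parallel>x - \<pi> x\<parallel>\<^sup>2\<close> (\<open>polar_sum_properties\<close>). So \<open>P\<close> is injective along with
  \<open>S\<close>, and \<open>\<parallel>S\<^sup>n x\<parallel> \<le> C \<parallel>P x\<parallel>\<close> for some constant \<open>C\<close>; hence \<open>S\<^sup>n = W P\<close> for some bounded \<open>W\<close>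
  (\<open>factor_through_dense_range\<close>). In general \<open>P\<close> has no bounded inverse, but \<open>A = P W\<close> replaces
  \<open>P S\<^sup>n P\<^sup>-\<^sup>1\<close>, and \<open>Q = W\<^sup>* W\<close> replaces \<open>P\<^sup>-\<^sup>1 G P\<^sup>-\<^sup>1\<close>.

  For (iii) take \<open>P\<close> to be the positive square root \<open>R\<close> of \<open>G\<close>, and \<open>Q = I\<close>. As \<open>S\<^sup>n\<close> is bounded below,
  so is \<open>R\<close>, which is therefore invertible, and \<open>A = R S\<^sup>n R\<^sup>-\<^sup>1\<close> is similar to \<open>S\<^sup>n\<close>.

  That \<open>P\<close> is what it is meant to be requires some operator theory on closed subspaces:
  projections, the Riesz theorem and adjoints (\<open>adjoint_on_exists\<close>), and existence and uniqueness of
  positive square roots (\<open>sqrt_on_exists\<close>), the latter from the binomial series of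
  \<open>sqrt (1 - z)\<close>.
\<close>

section \<open>Square roots on a real Hilbert space\<close>

text \<open>
  Square roots need only the real inner product. In a complex Hilbert space a positive operator is
  automatically self-adjoint; over the reals symmetry is an independent requirement.
\<close>
definition positive_operator :: "('a :: real_inner \<Rightarrow> 'a) \<Rightarrow> bool" where
  "positive_operator T \<longleftrightarrow> bounded_linear T \<and> (\<forall>x y. inner (T x) y = inner x (T y)) \<and>
     (\<forall>x. 0 \<le> inner x (T x))"

text \<open>
  Expand \<open>0 \<le> \<langle>y, T y\<rangle>\<close> for \<open>y = x - T x / C\<close>. The bound serves twice: it shows that \<open>I - T / C\<close> is a
  contraction, and that a positive operator kills every vector on which its form vanishes.
\<close>
lemma positive_operator_norm_bound:
  fixes T :: "'a :: real_inner \<Rightarrow> 'a"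
  assumes T: "positive_operator T" and C: "\<And>x. norm (T x) \<le> C * norm x" and "C > 0"
  shows "(norm (T x))\<^sup>2 \<le> C * inner x (T x)"
proof -
  interpret T: bounded_linear T using T by (simp add: positive_operator_def)
  have sym: "inner (T x) y = inner x (T y)" for x y
    using T by (simp add: positive_operator_def)
  define y where "y = x - (1 / C) *\<^sub>R T x"
  have "0 \<le> inner y (T y)" using T by (simp add: positive_operator_def)
  also have "inner y (T y) = inner x (T x) - 2 / C * (norm (T x))\<^sup>2
      + 1 / C\<^sup>2 * inner (T x) (T (T x))"
    by (simp add: y_def T.diff T.scaleR inner_diff_left inner_diff_right sym[of x "T x", symmetric] diff_divide_distrib
        power2_norm_eq_inner flip: power2_eq_square)
  also have "inner (T x) (T (T x)) \<le> norm (T x) * norm (T (T x))"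
    by (rule norm_cauchy_schwarz)
  also have "\<dots> \<le> C * (norm (T x))\<^sup>2"
    using mult_left_mono[OF C[of "T x"], of "norm (T x)"] by (simp add: power2_eq_square mult_ac)
  finally have "0 \<le> inner x (T x) - 2 / C * (norm (T x))\<^sup>2 + 1 / C\<^sup>2 * (C * (norm (T x))\<^sup>2)"
    using \<open>C > 0\<close> by (simp add: divide_right_mono)
  also have "\<dots> = inner x (T x) - (norm (T x))\<^sup>2 / C"
    using \<open>C > 0\<close> by (simp add: power2_eq_square)
  finally show ?thesis using \<open>C > 0\<close> by (simp add: field_simps)
qed

lemma positive_operator_bound:
  assumes "positive_operator T"
  obtains C where "C > 0" "\<And>x. norm (T x) \<le> C * norm x"
  using bounded_linear.pos_bounded[of T] assms
  by (auto simp: positive_operator_def mult.commute)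

lemma positive_operator_null:
  assumes "positive_operator T" "inner x (T x) = 0"
  shows "T x = 0"
proof -
  obtain C where C: "C > 0" "\<And>x. norm (T x) \<le> C * norm x"
    using positive_operator_bound[OF assms(1)] by blast
  show ?thesis
    using positive_operator_norm_bound[OF assms(1) C(2,1), of x] assms(2) by simp
qed

text \<open>
  The Taylor coefficients of \<open>sqrt (1 - z)\<close> at 0.
\<close>
definition sqrt_coeff :: "nat \<Rightarrow> real" where
  "sqrt_coeff k = (1/2 gchoose k) * (-1) ^ k"

lemma sqrt_coeff_0 [simp]: "sqrt_coeff 0 = 1"
  by (simp add: sqrt_coeff_def)

lemma signed_gbinomial_nonneg:
  assumes "a \<le> (0::real)"
  shows "0 \<le> (a gchoose k) * (-1) ^ k"
proof (induction k)
  case (Suc k)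
  have "(a gchoose Suc k) * (-1) ^ Suc k = (a gchoose k) * (-1) ^ k * ((real k - a) / real (Suc k))"
    by (simp add: gbinomial_Suc_rec field_simps)
  then show ?case using Suc assms by simp
qed simp

lemma sqrt_coeff_Suc_nonpos: "sqrt_coeff (Suc k) \<le> 0"
proof -
  have "sqrt_coeff (Suc k) = - (1 / (2 * real (Suc k))) * ((-1/2 gchoose k) * (-1) ^ k)"
    unfolding sqrt_coeff_def using gbinomial_absorption[of k "1/2::real"]
    by (simp add: field_simps)
  then show ?thesis using signed_gbinomial_nonneg[of "-1/2" k]
    by (simp add: mult_le_0_iff del: of_nat_Suc)
qed

lemma sum_sqrt_coeff_nonneg: "0 \<le> (\<Sum>k\<le>n. sqrt_coeff k)"
  using signed_gbinomial_nonneg[of "-1/2" n] gbinomial_sum_lower_neg[of "1/2::real" n]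
  by (simp add: sqrt_coeff_def mult.commute)

lemma abs_sqrt_coeff: "\<bar>sqrt_coeff k\<bar> = (if k = 0 then 2 else 0) - sqrt_coeff k"
  using sqrt_coeff_Suc_nonpos[of "k - 1"] by (cases k) auto

text \<open>
  The series of \<open>sqrt (1 - z)\<close> converges absolutely even at the boundary point \<open>z = 1\<close>: all
  coefficients but the first are nonpositive, while the partial sums at \<open>z = 1\<close> stay nonnegative.
\<close>
lemma summable_abs_sqrt_coeff: "summable (\<lambda>k. \<bar>sqrt_coeff k\<bar>)"
proof (rule bounded_imp_summable)
  show "(\<Sum>k\<le>n. \<bar>sqrt_coeff k\<bar>) \<le> 2" for n
    using sum_sqrt_coeff_nonneg[of n] by (simp add: abs_sqrt_coeff sum_subtractf)
qed auto

text \<open>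
  Vandermonde's identity: \<open>sqrt (1 - z) * sqrt (1 - z) = 1 - z\<close>, coefficient by coefficient.
\<close>
lemma sqrt_coeff_convolution:
  "(\<Sum>i\<le>k. sqrt_coeff i * sqrt_coeff (k - i)) = (if k = 0 then 1 else if k = 1 then -1 else 0)"
proof -
  have "(\<Sum>i\<le>k. sqrt_coeff i * sqrt_coeff (k - i))
      = (\<Sum>i\<le>k. (-1) ^ k * ((1/2 gchoose i) * (1/2 gchoose (k - i))))"
    by (intro sum.cong) (auto simp: sqrt_coeff_def mult_ac simp flip: power_add)
  also have "\<dots> = (-1) ^ k * ((1::real) gchoose k)"
    using gbinomial_Vandermonde[of "1/2::real" "1/2" k]
    by (simp add: atLeast0AtMost flip: sum_distrib_left)
  also have "(1::real) gchoose k = of_nat (1 choose k)"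
    by (simp add: binomial_gbinomial)
  also have "(-1) ^ k * real (1 choose k) = (if k = 0 then 1 else if k = 1 then -1 else 0)"
    by (cases "k \<le> 1") (auto simp: le_Suc_eq)
  finally show ?thesis .
qed

lemma contraction_funpow:
  fixes K :: "'a :: real_normed_vector \<Rightarrow> 'a"
  assumes "\<And>x. norm (K x) \<le> norm x"
  shows "norm ((K ^^ k) x) \<le> norm x"
proof (induction k)
  case (Suc k)
  have "norm (K ((K ^^ k) x)) \<le> norm ((K ^^ k) x)" by (rule assms)
  with Suc show ?case by simp
qed simp

lemma bounded_linear_funpow:
  fixes K :: "'a :: real_normed_vector \<Rightarrow> 'a"
  assumes "bounded_linear K"
  shows "bounded_linear (K ^^ k)"
proof (induction k)
  case 0
  show ?case using bounded_linear_ident by (simp only: funpow.simps id_def)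
next
  case (Suc k)
  from bounded_linear_compose[OF assms Suc] show ?case by (simp add: o_def)
qed

definition sqrt_series :: "('a \<Rightarrow> 'a) \<Rightarrow> 'a \<Rightarrow> 'a :: banach" where
  "sqrt_series K x = (\<Sum>k. sqrt_coeff k *\<^sub>R (K ^^ k) x)"

context
  fixes K :: "'a :: banach \<Rightarrow> 'a"
  assumes K: "bounded_linear K" and contr: "\<And>x. norm (K x) \<le> norm x"
begin

lemma norm_sqrt_term: "norm (sqrt_coeff k *\<^sub>R (K ^^ k) x) \<le> \<bar>sqrt_coeff k\<bar> * norm x"
  by (simp add: mult_left_mono contraction_funpow contr)

lemma summable_norm_sqrt_term: "summable (\<lambda>k. norm (sqrt_coeff k *\<^sub>R (K ^^ k) x))"
  by (rule summable_comparison_test'[OF summable_mult2[OF summable_abs_sqrt_coeff, of "norm x"]])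
    (simp add: norm_sqrt_term del: norm_scaleR)

lemma sqrt_series_sums: "(\<lambda>k. sqrt_coeff k *\<^sub>R (K ^^ k) x) sums sqrt_series K x"
  using summable_norm_cancel[OF summable_norm_sqrt_term] unfolding sqrt_series_def
  by (rule summable_sums)

lemma bounded_linear_sqrt_series: "bounded_linear (sqrt_series K)"
proof (rule bounded_linear_intro[where K = "\<Sum>k. \<bar>sqrt_coeff k\<bar>"])
  fix x y :: 'a and r :: real
  have lin: "linear (K ^^ k)" for k
    using bounded_linear_funpow[OF K] by (rule bounded_linear.linear)
  have "(\<lambda>k. sqrt_coeff k *\<^sub>R (K ^^ k) (x + y)) sums (sqrt_series K x + sqrt_series K y)"
    using sums_add[OF sqrt_series_sums[of x] sqrt_series_sums[of y]]
    by (simp add: linear_add[OF lin] scaleR_add_right)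
  then show "sqrt_series K (x + y) = sqrt_series K x + sqrt_series K y"
    using sqrt_series_sums sums_unique2 by blast
  have "(\<lambda>k. sqrt_coeff k *\<^sub>R (K ^^ k) (r *\<^sub>R x)) sums (r *\<^sub>R sqrt_series K x)"
    using sums_scaleR_right[OF sqrt_series_sums[of x], of r]
    by (simp add: linear_scale[OF lin] mult.commute)
  then show "sqrt_series K (r *\<^sub>R x) = r *\<^sub>R sqrt_series K x"
    using sqrt_series_sums sums_unique2 by blast
  have "norm (sqrt_series K x) \<le> (\<Sum>k. norm (sqrt_coeff k *\<^sub>R (K ^^ k) x))"
    unfolding sqrt_series_def by (rule summable_norm[OF summable_norm_sqrt_term])
  also have "\<dots> \<le> (\<Sum>k. \<bar>sqrt_coeff k\<bar> * norm x)"
    by (intro suminf_le norm_sqrt_term summable_norm_sqrt_term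
        summable_mult2 summable_abs_sqrt_coeff)
  also have "\<dots> = norm x * (\<Sum>k. \<bar>sqrt_coeff k\<bar>)"
    using suminf_mult2[OF summable_abs_sqrt_coeff, of "norm x"] by (simp add: mult.commute)
  finally show "norm (sqrt_series K x) \<le> norm x * (\<Sum>k. \<bar>sqrt_coeff k\<bar>)" .
qed

lemma sqrt_series_commute:
  assumes W: "bounded_linear W" and comm: "\<And>x. W (K x) = K (W x)"
  shows "W (sqrt_series K x) = sqrt_series K (W x)"
proof -
  have pow: "W ((K ^^ k) x) = (K ^^ k) (W x)" for k
    by (induction k) (simp_all add: comm)
  have "(\<lambda>k. W (sqrt_coeff k *\<^sub>R (K ^^ k) x)) sums W (sqrt_series K x)"
    by (rule bounded_linear.sums[OF W sqrt_series_sums])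
  then have "(\<lambda>k. sqrt_coeff k *\<^sub>R (K ^^ k) (W x)) sums W (sqrt_series K x)"
    using W by (simp add: linear_scale[OF bounded_linear.linear] pow)
  then show ?thesis
    using sqrt_series_sums sums_unique2 by blast
qed

text \<open>
  The square of the series is a double series which converges absolutely, so that it may be summed
  along the diagonals, where the coefficients are known.
\<close>
lemma sqrt_series_square: "sqrt_series K (sqrt_series K x) = x - K x"
proof -
  define f where "f = (\<lambda>i j. (sqrt_coeff i * sqrt_coeff j) *\<^sub>R (K ^^ (i + j)) x)"
  have abs_coeff: "(\<lambda>k. \<bar>sqrt_coeff k\<bar>) summable_on UNIV"
    by (simp add: summable_on_UNIV_nonneg_real_iff summable_abs_sqrt_coeff)
  have f_le: "norm (f i j) \<le> \<bar>sqrt_coeff i\<bar> * (\<bar>sqrt_coeff j\<bar> * norm x)" for i j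
    unfolding f_def
    using mult_left_mono[OF contraction_funpow[of K "i + j" x, OF contr],
        of "\<bar>sqrt_coeff i\<bar> * \<bar>sqrt_coeff j\<bar>"]
    by (simp add: abs_mult)
  have f_sum: "(\<lambda>(i, j). f i j) summable_on UNIV \<times> UNIV"
  proof (rule abs_summable_summable)
    have "(\<lambda>p. norm (case p of (i, j) \<Rightarrow> \<bar>sqrt_coeff i\<bar> * (\<bar>sqrt_coeff j\<bar> * norm x)))
        summable_on UNIV \<times> UNIV"
      unfolding Infinite_Sum.abs_summable_on_Sigma_iff
      by (auto simp: abs_mult infsum_cmult_right' abs_coeff
          intro!: summable_on_cmult_right summable_on_cmult_left)
    then show "(\<lambda>p. norm (case p of (i, j) \<Rightarrow> f i j)) summable_on UNIV \<times> UNIV"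
      by (rule Infinite_Sum.abs_summable_on_comparison_test) (use f_le in auto)
  qed
  have *: "(\<lambda>j. f i j) sums (sqrt_coeff i *\<^sub>R (K ^^ i) (sqrt_series K x))" for i
    using bounded_linear.sums[OF bounded_linear_funpow[OF K, of i] sqrt_series_sums[of x],
        THEN sums_scaleR_right, of "sqrt_coeff i"]
    unfolding f_def
    by (simp add: linear_scale[OF bounded_linear.linear[OF bounded_linear_funpow[OF K]]] funpow_add)
  have inner: "infsum (f i) UNIV = sqrt_coeff i *\<^sub>R (K ^^ i) (sqrt_series K x)" for i
  proof -
    have "summable (\<lambda>j. norm (f i j))"
      using f_le
      by (intro summable_comparison_test'[OF summable_mult[of _ "\<bar>sqrt_coeff i\<bar>",
              OF summable_mult2[OF summable_abs_sqrt_coeff, of "norm x"]]]) simp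
    then show ?thesis using * by (intro infsumI norm_summable_imp_has_sum)
  qed
  have "infsum (\<lambda>(i, j). f i j) (UNIV \<times> UNIV) = (\<Sum>\<^sub>\<infinity>i. sqrt_coeff i *\<^sub>R (K ^^ i) (sqrt_series K x))"
    using infsum_Sigma'_banach[OF f_sum] by (simp add: inner)
  also have "\<dots> = sqrt_series K (sqrt_series K x)"
    by (intro infsumI norm_summable_imp_has_sum summable_norm_sqrt_term sqrt_series_sums)
  finally have lhs: "sqrt_series K (sqrt_series K x) = infsum (\<lambda>(i, j). f i j) (UNIV \<times> UNIV)" ..
  \<comment> \<open>Reading the double series along the diagonals leaves only the coefficients of \<open>1 - z\<close>.\<close>
  define g where "g = (\<lambda>k i. f i (k - i))"
  have g_sum: "(\<lambda>(k, i). g k i) summable_on (SIGMA k:UNIV. {..k})"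
    using f_sum
    by (subst summable_on_reindex_bij_witness[of _ "\<lambda>(i, j). (i + j, i)" "\<lambda>(k, i). (i, k - i)"
          "UNIV \<times> UNIV" "\<lambda>(i, j). f i j"]) (auto simp: g_def)
  have "infsum (\<lambda>(i, j). f i j) (UNIV \<times> UNIV) = infsum (\<lambda>(k, i). g k i) (SIGMA k:UNIV. {..k})"
    by (rule infsum_reindex_bij_witness[of _ "\<lambda>(k, i). (i, k - i)" "\<lambda>(i, j). (i + j, i)"])
      (auto simp: g_def)
  also have "\<dots> = (\<Sum>\<^sub>\<infinity>k. \<Sum>i\<le>k. g k i)"
    using infsum_Sigma'_banach[OF g_sum] by simp
  also have "(\<lambda>k. \<Sum>i\<le>k. g k i) = (\<lambda>k. if k = 0 then x else if k = 1 then - K x else 0)"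
  proof
    fix k
    have "(\<Sum>i\<le>k. g k i) = (\<Sum>i\<le>k. sqrt_coeff i * sqrt_coeff (k - i)) *\<^sub>R (K ^^ k) x"
      by (simp add: g_def f_def scaleR_sum_left)
    then show "(\<Sum>i\<le>k. g k i) = (if k = 0 then x else if k = 1 then - K x else 0)"
      unfolding sqrt_coeff_convolution by simp
  qed
  also have "(\<Sum>\<^sub>\<infinity>k::nat. if k = 0 then x else if k = 1 then - K x else 0)
      = (\<Sum>\<^sub>\<infinity>k\<in>{0, 1::nat}. if k = 0 then x else if k = 1 then - K x else 0)"
    by (rule infsum_cong_neutral) auto
  also have "\<dots> = x - K x"
    by simp
  finally show ?thesis unfolding lhs .
qed

end

text \<open>
  For \<open>C\<close> an upper bound of the norm of \<open>T\<close>, the operator \<open>K = I - T / C\<close> is a contraction, and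
  \<open>sqrt C * sqrt (I - K)\<close> is the root. It is a norm limit of polynomials in \<open>T\<close>, hence commutes
  with whatever commutes with \<open>T\<close>; both uniqueness and complex linearity rest on this.
\<close>
theorem positive_square_root:
  fixes T :: "'a :: {real_inner, banach} \<Rightarrow> 'a"
  assumes T: "positive_operator T"
  obtains R where "positive_operator R" "\<And>x. R (R x) = T x"
    "\<And>W x. bounded_linear W \<Longrightarrow> (\<And>x. W (T x) = T (W x)) \<Longrightarrow> W (R x) = R (W x)"
proof -
  obtain C where C: "C > 0" "\<And>x. norm (T x) \<le> C * norm x"
    using positive_operator_bound[OF T] by blast
  have bl: "bounded_linear T" and sym: "inner (T x) y = inner x (T y)" for x y
    using T by (simp_all add: positive_operator_def)
  interpret T: bounded_linear T by (rule bl)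
  define K where "K = (\<lambda>x. x - (1 / C) *\<^sub>R T x)"
  have K: "bounded_linear K"
    unfolding K_def by (intro bounded_linear_intros bl)
  have K_sym: "inner (K x) y = inner x (K y)" for x y
    by (simp add: K_def inner_diff_left inner_diff_right sym)
  have K_contr: "norm (K x) \<le> norm x" for x
  proof (rule power2_le_imp_le)
    have "(norm (K x))\<^sup>2 = (norm x)\<^sup>2 - 2 / C * inner x (T x) + (norm (T x))\<^sup>2 / C\<^sup>2"
      unfolding K_def power2_norm_eq_inner using \<open>C > 0\<close>
      by (simp add: inner_diff_left inner_diff_right sym power2_eq_square field_simps
          inner_commute[of "T x" x])
    also have "(norm (T x))\<^sup>2 / C\<^sup>2 \<le> C * inner x (T x) / C\<^sup>2"
      by (intro divide_right_mono positive_operator_norm_bound[OF T C(2,1)]) simp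
    also have "\<dots> = inner x (T x) / C"
      using \<open>C > 0\<close> by (simp add: power2_eq_square)
    also have "(norm x)\<^sup>2 - 2 / C * inner x (T x) + \<dots> = (norm x)\<^sup>2 - inner x (T x) / C"
      by (simp add: field_simps)
    also have "\<dots> \<le> (norm x)\<^sup>2"
      using T \<open>C > 0\<close> by (simp add: positive_operator_def)
    finally show "(norm (K x))\<^sup>2 \<le> (norm x)\<^sup>2" by simp
  qed simp
  note sums = sqrt_series_sums[OF K K_contr] and series_bl = bounded_linear_sqrt_series[OF K K_contr]
  have Kpow_sym: "inner ((K ^^ k) x) y = inner x ((K ^^ k) y)" for k x y
    by (induction k arbitrary: x y) (simp_all add: K_sym funpow_swap1)
  have S_sym: "inner (sqrt_series K x) y = inner x (sqrt_series K y)" for x y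
  proof (rule sums_unique2)
    show "(\<lambda>k. inner (sqrt_coeff k *\<^sub>R (K ^^ k) x) y) sums inner (sqrt_series K x) y"
      by (rule bounded_linear.sums[OF bounded_linear_inner_left sums])
    show "(\<lambda>k. inner (sqrt_coeff k *\<^sub>R (K ^^ k) x) y) sums inner x (sqrt_series K y)"
      using bounded_linear.sums[OF bounded_linear_inner_right sums, of x y]
      by (simp add: Kpow_sym)
  qed
  have S_pos: "0 \<le> inner x (sqrt_series K x)" for x
  proof (rule LIMSEQ_le_const)
    show "(\<lambda>n. \<Sum>k\<le>n. inner x (sqrt_coeff k *\<^sub>R (K ^^ k) x)) \<longlonglongrightarrow> inner x (sqrt_series K x)"
      using bounded_linear.sums[OF bounded_linear_inner_right sums, of x x]
      by (simp only: sums_def_le)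
    have "0 \<le> (\<Sum>k\<le>n. inner x (sqrt_coeff k *\<^sub>R (K ^^ k) x))" for n
    proof -
      have "sqrt_coeff k * (norm x)\<^sup>2 \<le> inner x (sqrt_coeff k *\<^sub>R (K ^^ k) x)" for k
      proof (cases k)
        case 0
        then show ?thesis by (simp add: power2_norm_eq_inner)
      next
        case (Suc j)
        have "inner x ((K ^^ k) x) \<le> norm x * norm ((K ^^ k) x)" by (rule norm_cauchy_schwarz)
        also have "\<dots> \<le> (norm x)\<^sup>2"
          by (simp add: power2_eq_square mult_left_mono contraction_funpow K_contr)
        finally show ?thesis
          using sqrt_coeff_Suc_nonpos[of j] Suc by (simp add: mult_left_mono_neg)
      qed
      then have "(\<Sum>k\<le>n. sqrt_coeff k * (norm x)\<^sup>2) \<le> (\<Sum>k\<le>n. inner x (sqrt_coeff k *\<^sub>R (K ^^ k) x))"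
        by (rule sum_mono)
      moreover have "0 \<le> (\<Sum>k\<le>n. sqrt_coeff k * (norm x)\<^sup>2)"
        by (simp add: sum_sqrt_coeff_nonneg flip: sum_distrib_right)
      ultimately show ?thesis by linarith
    qed
    then show "\<exists>N. \<forall>n\<ge>N. 0 \<le> (\<Sum>k\<le>n. inner x (sqrt_coeff k *\<^sub>R (K ^^ k) x))" by blast
  qed
  define R where "R = (\<lambda>x. sqrt C *\<^sub>R sqrt_series K x)"
  have R_bl: "bounded_linear R"
    unfolding R_def by (intro bounded_linear_intros series_bl)
  show thesis
  proof
    show "positive_operator R"
      using R_bl \<open>C > 0\<close> by (simp add: positive_operator_def R_def S_sym S_pos)
    show "R (R x) = T x" for x
      using \<open>C > 0\<close> linear_scale[OF bounded_linear.linear[OF series_bl]]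
      by (simp add: R_def sqrt_series_square[OF K K_contr]) (simp add: K_def)
    show "W (R x) = R (W x)" if W: "bounded_linear W" and comm: "\<And>x. W (T x) = T (W x)" for W x
    proof -
      have "W (K x) = K (W x)" for x
        using W by (simp add: K_def comm linear_simps)
      then show ?thesis
        using sqrt_series_commute[OF K K_contr W] W by (simp add: R_def linear_simps)
    qed
  qed
qed

text \<open>
  If positive \<open>A\<close> and \<open>B\<close> commute and \<open>A\<^sup>2 = B\<^sup>2\<close>, then with \<open>y = (A - B) x\<close> the vector
  \<open>(A + B) y = 0\<close>, so both nonnegative numbers \<open>\<langle>y, A y\<rangle>\<close> and \<open>\<langle>y, B y\<rangle>\<close> vanish, then \<open>A y\<close> and
  \<open>B y\<close>, and finally \<open>y\<close>. Any root of \<open>T\<close> commutes with \<open>T\<close>, hence with the root constructed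
  above, and so coincides with it.
\<close>
theorem positive_square_root_unique:
  fixes T R R' :: "'a :: {real_inner, banach} \<Rightarrow> 'a"
  assumes pos: "positive_operator R" "positive_operator R'"
    and sq: "\<And>x. R (R x) = R' (R' x)"
    shows "R = R'"
proof -
  have main: "A = B" if A: "positive_operator A" and B: "positive_operator B"
    and AB: "\<And>x. A (A x) = B (B x)" and comm: "\<And>x. A (B x) = B (A x)" for A B :: "'a \<Rightarrow> 'a"
  proof
    fix x
    interpret A: bounded_linear A using A by (simp add: positive_operator_def)
    interpret B: bounded_linear B using B by (simp add: positive_operator_def)
    define y where "y = A x - B x"
    have "A y + B y = 0"
      by (simp add: y_def A.diff B.diff AB comm)
    then have "inner y (A y) + inner y (B y) = 0"
      by (simp flip: inner_add_right)
    moreover have "0 \<le> inner y (A y)" "0 \<le> inner y (B y)"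
      using A B by (simp_all add: positive_operator_def)
    ultimately have "A y = 0" "B y = 0"
      by (simp_all add: positive_operator_null[OF A] positive_operator_null[OF B])
    then have "inner y (A x - B x) = 0"
      using A B by (simp add: inner_diff_right positive_operator_def) (metis inner_zero_left)
    then show "A x = B x" by (simp add: y_def)
  qed
  define T where "T = (\<lambda>x. R (R x))"
  have "positive_operator T"
    using pos(1) by (auto simp: positive_operator_def T_def intro: bounded_linear_compose)
       (metis inner_ge_zero)
  then obtain R0 where R0: "positive_operator R0" "\<And>x. R0 (R0 x) = T x"
    "\<And>W x. bounded_linear W \<Longrightarrow> (\<And>x. W (T x) = T (W x)) \<Longrightarrow> W (R0 x) = R0 (W x)"
    using positive_square_root by blast
  have "W = R0" if "positive_operator W" "\<And>x. W (W x) = T x" for W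
  proof (rule main)
    show "W (R0 x) = R0 (W x)" for x
      using that by (intro R0(3)) (simp_all add: positive_operator_def flip: that(2))
  qed (use that R0 in auto)
  from this[of R] this[of R'] show ?thesis using pos sq by (simp add: T_def)
qed

section \<open>The projection theorem and the Riesz theorem\<close>

text \<open>
  A minimising sequence for the distance from \<open>x\<close> to \<open>M\<close> is Cauchy by the parallelogram law; its limit
  is the nearest point, and minimality along lines through it is orthogonality.
\<close>
lemma orthogonal_projection_exists:
  fixes M :: "'a :: {real_inner, banach} set"
  assumes M: "subspace M" "closed M"
  shows "\<exists>u\<in>M. \<forall>w\<in>M. inner (x - u) w = 0"
proof -
  define D where "D = infdist x M"
  have "M \<noteq> {}" using subspace_0[OF M(1)] by blast
  have D_le: "D \<le> norm (x - w)" if "w \<in> M" for w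
    using infdist_le[OF that, of x] by (simp add: D_def dist_norm)
  have "D \<ge> 0" by (simp add: D_def infdist_nonneg)
  have "\<exists>w\<in>M. norm (x - w) < D + e" if "e > 0" for e
  proof (rule ccontr)
    assume "\<not> ?thesis"
    then have "D + e \<le> D"
      unfolding D_def infdist_notempty[OF \<open>M \<noteq> {}\<close>]
      by (intro cINF_greatest \<open>M \<noteq> {}\<close>) (auto simp: dist_norm infdist_notempty[OF \<open>M \<noteq> {}\<close>] D_def not_less)
    with that show False by simp
  qed
  then have "\<exists>w\<in>M. norm (x - w) < D + 1 / real (Suc k)" for k by simp
  then obtain w where w: "\<And>k. w k \<in> M" "\<And>k. norm (x - w k) < D + 1 / real (Suc k)" by metis
  have lim: "(\<lambda>k. D + 1 / real (Suc k)) \<longlonglongrightarrow> D"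
    using tendsto_add[OF tendsto_const[of D] LIMSEQ_inverse_real_of_nat]
    by (simp add: inverse_eq_divide)
  \<comment> \<open>Parallelogram law: two near-minimisers are close, since their midpoint is in \<open>M\<close>.\<close>
  have par: "(norm (a - b))\<^sup>2 \<le> 2 * (norm (x - a))\<^sup>2 + 2 * (norm (x - b))\<^sup>2 - 4 * D\<^sup>2"
    if "a \<in> M" "b \<in> M" for a b
  proof -
    define c where "c = (1/2) *\<^sub>R (a + b)"
    have "c \<in> M" unfolding c_def using that M by (simp add: subspace_add subspace_scale)
    then have "D\<^sup>2 \<le> (norm (x - c))\<^sup>2" using D_le \<open>D \<ge> 0\<close> by (simp add: power_mono)
    moreover have "(norm (a - b))\<^sup>2 = 2 * (norm (x - a))\<^sup>2 + 2 * (norm (x - b))\<^sup>2 - 4 * (norm (x - c))\<^sup>2"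
      by (simp add: c_def power2_norm_eq_inner inner_diff_left inner_diff_right inner_add_left
          inner_add_right inner_commute algebra_simps)
    ultimately show ?thesis by linarith
  qed
  have "Cauchy w"
  proof (rule metric_CauchyI)
    fix e :: real assume "e > 0"
    have "(\<lambda>k. 4 * (D + 1 / real (Suc k))\<^sup>2 - 4 * D\<^sup>2) \<longlonglongrightarrow> 4 * D\<^sup>2 - 4 * D\<^sup>2"
      by (intro tendsto_intros lim)
    then have "eventually (\<lambda>k. 4 * (D + 1 / real (Suc k))\<^sup>2 - 4 * D\<^sup>2 < e\<^sup>2) sequentially"
      using \<open>e > 0\<close> by (auto intro: order_tendstoD)
    then obtain N where N: "4 * (D + 1 / real (Suc N))\<^sup>2 - 4 * D\<^sup>2 < e\<^sup>2"
      by (auto simp: eventually_sequentially)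
    have bd: "(norm (x - w k))\<^sup>2 \<le> (D + 1 / real (Suc N))\<^sup>2" if "k \<ge> N" for k
    proof (rule power_mono)
      have "1 / real (Suc k) \<le> 1 / real (Suc N)" using that by (simp add: frac_le)
      then show "norm (x - w k) \<le> D + 1 / real (Suc N)" using w(2)[of k] by linarith
    qed simp
    have "dist (w i) (w j) < e" if "i \<ge> N" "j \<ge> N" for i j
    proof -
      have "(norm (w i - w j))\<^sup>2 < e\<^sup>2"
        using par[OF w(1)[of i] w(1)[of j]] bd[OF that(1)] bd[OF that(2)] N by linarith
      then show ?thesis
        using \<open>e > 0\<close> by (simp add: dist_norm power_less_imp_less_base)
    qed
    then show "\<exists>N. \<forall>i\<ge>N. \<forall>j\<ge>N. dist (w i) (w j) < e" by blast
  qed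
  then obtain u where u: "w \<longlonglongrightarrow> u" using Cauchy_convergent convergent_def by blast
  have "u \<in> M" using closed_sequentially[OF M(2) w(1) u] .
  have "norm (x - u) \<le> D"
    by (rule LIMSEQ_le[OF tendsto_norm[OF tendsto_diff[OF tendsto_const u]] lim])
       (use w(2) less_imp_le in blast)
  then have min: "norm (x - u) \<le> norm (x - v)" if "v \<in> M" for v
    using D_le[OF that] by simp
  have "inner (x - u) v = 0" if "v \<in> M" for v
  proof (cases "v = 0")
    case False
    define t where "t = inner (x - u) v / inner v v"
    have "u + t *\<^sub>R v \<in> M" using \<open>u \<in> M\<close> that M by (simp add: subspace_add subspace_scale)
    from min[OF this] have "(norm (x - u))\<^sup>2 \<le> (norm (x - u - t *\<^sub>R v))\<^sup>2"
      by (simp add: diff_diff_eq power_mono)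
    also have "\<dots> = (norm (x - u))\<^sup>2 - (inner (x - u) v)\<^sup>2 / inner v v"
      using False unfolding power2_norm_eq_inner
      by (simp add: inner_diff_left[of "x - u"] inner_diff_right[of _ "x - u"]
          inner_commute[of v "x - u"] t_def power2_eq_square)
    finally have "(inner (x - u) v)\<^sup>2 / inner v v \<le> 0" by simp
    moreover have "inner v v > 0" using False by simp
    ultimately show ?thesis by (simp add: divide_le_0_iff)
  qed simp
  with \<open>u \<in> M\<close> show ?thesis by blast
qed

text \<open>
  A nonzero functional is determined by its kernel up to a factor; project onto the kernel to find
  the vector orthogonal to it.
\<close>
lemma riesz_representation:
  fixes f :: "'a :: {real_inner, banach} \<Rightarrow> real"
  assumes f: "bounded_linear f"
  shows "\<exists>z. \<forall>x. f x = inner x z"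
proof (cases "\<forall>x. f x = 0")
  case False
  interpret f: bounded_linear f by (rule f)
  from False obtain x where "f x \<noteq> 0" by blast
  have "subspace {x. f x = 0}" by (simp add: subspace_def f.add f.scaleR)
  moreover have "closed {x. f x = 0}"
    by (intro closed_Collect_eq continuous_intros f.continuous_on)
  ultimately obtain u where u: "f u = 0" "\<And>w. f w = 0 \<Longrightarrow> inner (x - u) w = 0"
    using orthogonal_projection_exists[of "{x. f x = 0}" x] by auto
  define v where "v = x - u"
  have "f v \<noteq> 0" by (simp add: v_def f.diff u \<open>f x \<noteq> 0\<close>)
  then have "v \<noteq> 0" using f.zero by auto
  have "f y = inner y ((f v / inner v v) *\<^sub>R v)" for y
  proof -
    have "inner v (y - (f y / f v) *\<^sub>R v) = 0"
      unfolding v_def by (rule u(2)) (use \<open>f v \<noteq> 0\<close> in \<open>simp add: f.diff f.scaleR flip: v_def\<close>)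
    then show ?thesis
      using \<open>f v \<noteq> 0\<close> \<open>v \<noteq> 0\<close> by (simp add: inner_diff_right inner_commute field_simps)
  qed
  then show ?thesis by blast
qed (auto intro: exI[of _ 0])

section \<open>Operators on complex Hilbert spaces\<close>

text \<open>
  For the real inner product, too, the adjoint of multiplication by a scalar is multiplication by its
  conjugate. With this, adjoints and positivity can be studied through the real inner product alone.
\<close>
lemma inner_scaleC_right: "inner x (c *\<^sub>C y) = inner (cnj c *\<^sub>C x) y"
  for x y :: "'a :: complex_hilbert_space"
proof -
  have "cinner x (c *\<^sub>C y) = cinner (cnj c *\<^sub>C x) y"
    using cinner_commute[of "cnj c *\<^sub>C x" y] cinner_commute[of x y]
    by (simp add: cinner_scaleC_right)
  then show ?thesis by (simp add: inner_Re_cinner)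
qed

lemma Re_cinner: "Re (cinner x y) = inner x y"
  by (simp add: inner_Re_cinner)

lemma Im_cinner: "Im (cinner x y) = - inner x (\<i> *\<^sub>C y)"
  by (simp add: inner_Re_cinner cinner_scaleC_right)

lemma cinner_eq_iff:
  "cinner x y = cinner x' y' \<longleftrightarrow> inner x y = inner x' y' \<and> inner x (\<i> *\<^sub>C y) = inner x' (\<i> *\<^sub>C y')"
  by (simp add: complex_eq_iff Re_cinner Im_cinner)

lemma norm_scaleC: "norm (c *\<^sub>C x) = cmod c * norm x"
  for x :: "'a :: complex_hilbert_space"
proof -
  have "(norm (c *\<^sub>C x))\<^sup>2 = inner ((cnj c * c) *\<^sub>C x) x"
    by (simp add: power2_norm_eq_inner inner_scaleC_right scaleC_scaleC)
  also have "(cnj c * c) *\<^sub>C x = (cmod c)\<^sup>2 *\<^sub>R x"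
    by (simp only: complex_norm_square scaleR_scaleC mult.commute)
  finally show ?thesis
    by (simp add: power2_norm_eq_inner[symmetric] power_mult_distrib[symmetric])
qed

lemma bounded_linear_scaleC: "bounded_linear (\<lambda>x :: 'a :: complex_hilbert_space. c *\<^sub>C x)"
  by (rule bounded_linear_intro[of _ "cmod c"])
    (simp_all add: scaleC_add_right scaleR_scaleC scaleC_scaleC norm_scaleC mult.commute)

abbreviation csubspace :: "'a :: complex_hilbert_space set \<Rightarrow> bool" where
  "csubspace \<equiv> complex_vector.subspace"

lemma csubspace_imp_subspace: "csubspace M \<Longrightarrow> subspace M"
  by (auto simp: subspace_def complex_vector.subspace_def scaleR_scaleC)

lemma bounded_operatorsD:
  assumes "T \<in> bounded_operators M"
  shows "x \<in> M \<Longrightarrow> T x \<in> M" "x \<in> M \<Longrightarrow> y \<in> M \<Longrightarrow> T (x + y) = T x + T y"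
    "x \<in> M \<Longrightarrow> T (c *\<^sub>C x) = c *\<^sub>C T x" "x \<notin> M \<Longrightarrow> T x = 0"
  using assms by (auto simp: bounded_operators_def)

lemma bounded_operators_bound:
  assumes "T \<in> bounded_operators M"
  shows "\<exists>K\<ge>0. \<forall>x\<in>M. norm (T x) \<le> K * norm x"
proof -
  from assms obtain K where K: "\<And>x. x \<in> M \<Longrightarrow> norm (T x) \<le> K * norm x"
    unfolding bounded_operators_def by blast
  have "norm (T x) \<le> \<bar>K\<bar> * norm x" if "x \<in> M" for x
    using order.trans[OF K[OF that] mult_right_mono[of K "\<bar>K\<bar>" "norm x"]] by simp
  then show ?thesis by (intro exI[of _ "\<bar>K\<bar>"]) simp
qed

lemma BH_bounded_linear: "T \<in> BH \<Longrightarrow> bounded_linear T"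
  by (simp add: BH_iff)

lemma BH_scaleC: "T \<in> BH \<Longrightarrow> T (c *\<^sub>C x) = c *\<^sub>C T x"
  by (simp add: BH_iff)

lemma BH_comp: "S \<in> BH \<Longrightarrow> T \<in> BH \<Longrightarrow> S \<circ> T \<in> BH"
  by (auto simp: BH_iff o_def intro: bounded_linear_compose)

lemma BH_id: "id \<in> BH"
  by (simp add: BH_iff id_def bounded_linear_ident)

lemma BH_diff: "S \<in> BH \<Longrightarrow> T \<in> BH \<Longrightarrow> (\<lambda>x. S x - T x) \<in> BH"
  by (auto simp: BH_iff bounded_linear_sub complex_vector.scale_right_diff_distrib)

lemma BH_funpow: "T \<in> BH \<Longrightarrow> T ^^ n \<in> BH"
  by (induction n) (simp_all add: BH_id BH_comp del: id_apply)

section \<open>Adjoints and positivity on a closed subspace\<close>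

definition orth_proj :: "'a :: complex_hilbert_space set \<Rightarrow> 'a \<Rightarrow> 'a" where
  "orth_proj M x = (SOME u. u \<in> M \<and> (\<forall>w\<in>M. inner (x - u) w = 0))"

context
  fixes M :: "'a :: complex_hilbert_space set"
  assumes M: "csubspace M" and closed: "closed M"
begin

lemma orth_proj_in: "orth_proj M x \<in> M"
  and orth_proj_orthogonal: "w \<in> M \<Longrightarrow> inner (x - orth_proj M x) w = 0"
proof -
  have "\<exists>u. u \<in> M \<and> (\<forall>w\<in>M. inner (x - u) w = 0)"
    using orthogonal_projection_exists[OF csubspace_imp_subspace[OF M] closed, of x] by blast
  from someI_ex[OF this]
  show "orth_proj M x \<in> M" "w \<in> M \<Longrightarrow> inner (x - orth_proj M x) w = 0"
    unfolding orth_proj_def by auto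
qed

lemma orth_proj_eqI:
  assumes "u \<in> M" "\<And>w. w \<in> M \<Longrightarrow> inner (x - u) w = 0"
  shows "orth_proj M x = u"
proof -
  have d: "orth_proj M x - u \<in> M"
    using orth_proj_in assms(1) M by (simp add: complex_vector.subspace_diff)
  have "inner (orth_proj M x - u) (orth_proj M x - u)
      = inner (x - u) (orth_proj M x - u) - inner (x - orth_proj M x) (orth_proj M x - u)"
    by (simp add: inner_diff_left)
  also have "\<dots> = 0" using d assms(2) orth_proj_orthogonal by simp
  finally show ?thesis by simp
qed

lemma orth_proj_id: "x \<in> M \<Longrightarrow> orth_proj M x = x"
  by (rule orth_proj_eqI) auto

lemma orth_proj_adjoint: "w \<in> M \<Longrightarrow> inner (orth_proj M x) w = inner x w"
  using orth_proj_orthogonal[of w x] by (simp add: inner_diff_left)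

lemma orth_proj_sym: "inner (orth_proj M x) y = inner x (orth_proj M y)"
proof -
  have "inner (orth_proj M x) y = inner (orth_proj M y) (orth_proj M x)"
    using orth_proj_adjoint[OF orth_proj_in, of y x] by (simp only: inner_commute[of "orth_proj M x" y])
  also have "\<dots> = inner x (orth_proj M y)"
    using orth_proj_adjoint[OF orth_proj_in, of x y] by (simp only: inner_commute[of "orth_proj M y"])
  finally show ?thesis .
qed

lemma orth_proj_BH: "orth_proj M \<in> BH"
proof -
  have add: "orth_proj M (x + y) = orth_proj M x + orth_proj M y" for x y
    by (rule orth_proj_eqI) (simp_all add: complex_vector.subspace_add[OF M] orth_proj_in
        orth_proj_adjoint inner_diff_left inner_add_left)
  have scale: "orth_proj M (c *\<^sub>C x) = c *\<^sub>C orth_proj M x" for c x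
  proof (rule orth_proj_eqI)
    show "c *\<^sub>C orth_proj M x \<in> M" by (simp add: M complex_vector.subspace_scale orth_proj_in)
    fix w assume "w \<in> M"
    then have "inner w (c *\<^sub>C (x - orth_proj M x)) = 0"
      unfolding inner_scaleC_right using orth_proj_orthogonal[of "cnj c *\<^sub>C w" x] M
      by (simp add: complex_vector.subspace_scale inner_commute)
    then show "inner (c *\<^sub>C x - c *\<^sub>C orth_proj M x) w = 0"
      by (simp add: complex_vector.scale_right_diff_distrib inner_commute)
  qed
  have bound: "norm (orth_proj M x) \<le> norm x" for x
  proof -
    have "norm (orth_proj M x) * norm (orth_proj M x) = inner x (orth_proj M x)"
      using orth_proj_adjoint[OF orth_proj_in, of x x]
      by (simp add: power2_norm_eq_inner flip: power2_eq_square)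
    also have "\<dots> \<le> norm x * norm (orth_proj M x)" by (rule norm_cauchy_schwarz)
    finally show ?thesis by (cases "orth_proj M x = 0") auto
  qed
  show ?thesis
    unfolding bounded_operators_def using bound by (auto simp: add scale intro!: exI[of _ 1])
qed

lemma comp_orth_proj_BH:
  assumes "T \<in> bounded_operators M"
  shows "T \<circ> orth_proj M \<in> BH"
proof -
  note p = bounded_operatorsD[OF orth_proj_BH]
  obtain K where K: "K \<ge> 0" "\<forall>x\<in>M. norm (T x) \<le> K * norm x"
    using bounded_operators_bound[OF assms] by blast
  obtain L where L: "L \<ge> 0" "\<forall>x\<in>UNIV. norm (orth_proj M x) \<le> L * norm x"
    using bounded_operators_bound[OF orth_proj_BH] by blast
  have "norm (T (orth_proj M x)) \<le> K * L * norm x" for x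
    using bspec[OF K(2) orth_proj_in, of x] mult_left_mono[OF bspec[OF L(2) UNIV_I, of x] K(1)]
    by (simp add: mult.assoc)
  then have "\<exists>K. \<forall>x. norm (T (orth_proj M x)) \<le> K * norm x" by blast
  then show ?thesis
    by (simp add: bounded_operators_def p(2,3) bounded_operatorsD(2,3)[OF assms] orth_proj_in)
qed

text \<open>
  Linearity holds because inner products with \<open>M\<close> determine the elements of \<open>M\<close>, and boundedness
  because \<open>\<parallel>T' y\<parallel>\<^sup>2 = \<langle>T (T' y), y\<rangle>\<close>.
\<close>
lemma bounded_operators_adjointI:
  assumes T: "T \<in> bounded_operators M"
    and in_M: "\<And>y. y \<in> M \<Longrightarrow> T' y \<in> M" and out: "\<And>y. y \<notin> M \<Longrightarrow> T' y = 0"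
    and eq: "\<And>x y. x \<in> M \<Longrightarrow> y \<in> M \<Longrightarrow> inner (T x) y = inner x (T' y)"
  shows "T' \<in> bounded_operators M"
proof -
  note T_M = bounded_operatorsD[OF T]
  have eqI: "u = v" if "u \<in> M" "v \<in> M" "\<And>x. x \<in> M \<Longrightarrow> inner x u = inner x v" for u v
  proof -
    have "inner (u - v) (u - v) = 0"
      using that(3)[of "u - v"] that M by (simp add: complex_vector.subspace_diff inner_diff_right)
    then show ?thesis by simp
  qed
  have "T' (x + y) = T' x + T' y" if "x \<in> M" "y \<in> M" for x y
    by (rule eqI) (use that M in \<open>simp_all add: in_M complex_vector.subspace_add inner_add_right
        flip: eq\<close>)
  moreover have "T' (c *\<^sub>C y) = c *\<^sub>C T' y" if "y \<in> M" for c y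
    by (rule eqI) (use that M T_M in \<open>simp_all add: in_M complex_vector.subspace_scale
        inner_scaleC_right flip: eq\<close>)
  moreover obtain K where K: "K \<ge> 0" "\<forall>x\<in>M. norm (T x) \<le> K * norm x"
    using bounded_operators_bound[OF T] by blast
  moreover have "norm (T' y) \<le> K * norm y" if "y \<in> M" for y
  proof -
    have "norm (T' y) * norm (T' y) = inner (T (T' y)) y"
      using that by (simp add: eq in_M power2_norm_eq_inner flip: power2_eq_square)
    also have "\<dots> \<le> norm (T (T' y)) * norm y" by (rule norm_cauchy_schwarz)
    also have "\<dots> \<le> K * norm (T' y) * norm y"
      by (intro mult_right_mono bspec[OF K(2)] in_M that) simp
    finally show ?thesis
      using K(1) by (cases "T' y = 0") (auto simp: mult_ac)
  qed
  ultimately show ?thesis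
    unfolding bounded_operators_def using in_M out by blast
qed

lemma cinner_adjointI:
  assumes "T' \<in> bounded_operators M" "y \<in> M"
    and "\<And>y. y \<in> M \<Longrightarrow> inner (T x) y = inner x (T' y)"
  shows "cinner (T x) y = cinner x (T' y)"
  using assms M by (simp add: cinner_eq_iff complex_vector.subspace_scale
      bounded_operatorsD(3)[OF assms(1), symmetric])

text \<open>
  The Riesz theorem applied to the functionals \<open>x \<mapsto> \<langle>T (\<pi> x), y\<rangle>\<close>, with \<open>\<pi>\<close> the projection onto \<open>M\<close>,
  followed by projecting the representing vectors back into \<open>M\<close>.
\<close>
lemma adjoint_on_exists:
  assumes T: "T \<in> bounded_operators M"
  shows "adjoint_on M T \<in> bounded_operators M"
    and "x \<in> M \<Longrightarrow> y \<in> M \<Longrightarrow> inner (T x) y = inner x (adjoint_on M T y)"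
proof -
  have "\<exists>z. \<forall>x. inner (T (orth_proj M x)) y = inner x z" for y
  proof (rule riesz_representation)
    show "bounded_linear (\<lambda>x. inner (T (orth_proj M x)) y)"
      using BH_bounded_linear[OF comp_orth_proj_BH[OF T]]
      by (auto simp: o_def intro: bounded_linear_compose[OF bounded_linear_inner_left])
  qed
  then obtain z where z: "\<And>x y. inner (T (orth_proj M x)) y = inner x (z y)" by metis
  define T' where "T' = (\<lambda>y. if y \<in> M then orth_proj M (z y) else 0)"
  have eq: "inner (T x) y = inner x (T' y)" if "x \<in> M" "y \<in> M" for x y
    using that z[of x y] by (simp add: T'_def orth_proj_id flip: orth_proj_sym)
  have T': "T' \<in> bounded_operators M"
    by (rule bounded_operators_adjointI[OF T _ _ eq]) (auto simp: T'_def orth_proj_in)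
  have unique: "T'' = T'" if "T'' \<in> bounded_operators M \<and>
      (\<forall>x\<in>M. \<forall>y\<in>M. cinner (T x) y = cinner x (T'' y))" for T''
  proof
    fix y
    show "T'' y = T' y"
    proof (cases "y \<in> M")
      case True
      have in_M: "T'' y \<in> M" "T' y \<in> M"
        using that T' True by (auto intro: bounded_operatorsD)
      have "inner x (T'' y) = inner x (T' y)" if "x \<in> M" for x
        using \<open>_ \<and> _\<close> True eq[OF that True] that by (metis Re_cinner)
      from this[of "T'' y - T' y"] have "inner (T'' y - T' y) (T'' y - T' y) = 0"
        using in_M M by (simp add: complex_vector.subspace_diff inner_diff_right)
      then show ?thesis by simp
    qed (use that T' in \<open>auto simp: bounded_operatorsD(4)\<close>)
  qed
  have "adjoint_on M T = T'"
    unfolding adjoint_on_def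
    using T' cinner_adjointI[OF T'] eq unique by (intro the_equality) auto
  then show "adjoint_on M T \<in> bounded_operators M"
    "x \<in> M \<Longrightarrow> y \<in> M \<Longrightarrow> inner (T x) y = inner x (adjoint_on M T y)"
    using T' eq by auto
qed

text \<open>
  Over the complex numbers a real quadratic form forces symmetry, by polarisation. This translates
  the complex notion of positivity into the real one.
\<close>
lemma positive_on_iff:
  "positive_on M Q \<longleftrightarrow> Q \<in> bounded_operators M \<and>
     (\<forall>x\<in>M. \<forall>y\<in>M. inner (Q x) y = inner x (Q y)) \<and> (\<forall>x\<in>M. 0 \<le> inner x (Q x))"
proof (intro iffI conjI ballI; (elim conjE)?)
  assume pos: "positive_on M Q"
  then show Q: "Q \<in> bounded_operators M" by (simp add: positive_on_def)
  note Q_M = bounded_operatorsD[OF Q]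
  have real: "inner x (\<i> *\<^sub>C Q x) = 0" and nn: "0 \<le> inner x (Q x)" if "x \<in> M" for x
    using pos that unfolding positive_on_def
    by (auto simp: complex_nonneg_Reals_iff Re_cinner Im_cinner)
  show "0 \<le> inner x (Q x)" if "x \<in> M" for x by (rule nn[OF that])
  fix x y assume xy: "x \<in> M" "y \<in> M"
  \<comment> \<open>Polarisation at \<open>x + \<i> y\<close>.\<close>
  have iy: "\<i> *\<^sub>C y \<in> M" using M xy by (simp add: complex_vector.subspace_scale)
  have "inner (x + \<i> *\<^sub>C y) (\<i> *\<^sub>C Q (x + \<i> *\<^sub>C y)) = 0"
    by (rule real) (use M xy iy in \<open>simp add: complex_vector.subspace_add\<close>)
  then have "inner x (\<i> *\<^sub>C \<i> *\<^sub>C Q y) + inner (\<i> *\<^sub>C y) (\<i> *\<^sub>C Q x) = 0"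
    using real[OF xy(1)] real[OF iy] xy iy
    by (simp add: Q_M(2,3) scaleC_add_right inner_add_left inner_add_right inner_diff_right)
  then have "inner y (Q x) = inner x (Q y)"
    by (simp add: inner_scaleC_right scaleC_scaleC scaleC_one complex_vector.scale_minus_left)
  then show "inner (Q x) y = inner x (Q y)" by (simp add: inner_commute)
next
  assume Q: "Q \<in> bounded_operators M"
    and sym: "\<forall>x\<in>M. \<forall>y\<in>M. inner (Q x) y = inner x (Q y)" and nn: "\<forall>x\<in>M. 0 \<le> inner x (Q x)"
  have "inner x (\<i> *\<^sub>C Q x) = 0" if "x \<in> M" for x
  proof -
    have ix: "\<i> *\<^sub>C x \<in> M" using M that by (simp add: complex_vector.subspace_scale)
    have "inner x (\<i> *\<^sub>C Q x) = inner (Q x) (\<i> *\<^sub>C x)"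
      using sym that ix by (simp flip: bounded_operatorsD(3)[OF Q])
    also have "\<dots> = - inner x (\<i> *\<^sub>C Q x)"
      by (subst inner_scaleC_right) (simp add: complex_vector.scale_minus_left inner_commute)
    finally show ?thesis by simp
  qed
  with nn Q show "positive_on M Q"
    unfolding positive_on_def by (auto simp: complex_nonneg_Reals_iff Re_cinner Im_cinner)
qed

end

section \<open>Square roots on a closed subspace\<close>

lemma BH_adj:
  assumes "T \<in> BH"
  shows "adj T \<in> BH" and "inner (T x) y = inner x (adj T y)"
  using adjoint_on_exists[OF complex_vector.subspace_UNIV closed_UNIV assms] by auto

lemma positive_on_UNIV_iff:
  "positive_on UNIV Q \<longleftrightarrow> Q \<in> BH \<and> positive_operator Q"
  by (auto simp: positive_on_iff[OF complex_vector.subspace_UNIV closed_UNIV]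
      positive_operator_def BH_bounded_linear)

lemma csubspace_closure:
  assumes "csubspace M"
  shows "csubspace (closure M)"
  unfolding complex_vector.subspace_def
proof (intro conjI ballI allI)
  show "0 \<in> closure M"
    using complex_vector.subspace_0[OF assms] closure_subset by blast
next
  fix x y assume "x \<in> closure M" "y \<in> closure M"
  then obtain f g where "\<And>k. f k \<in> M" "f \<longlonglongrightarrow> x" "\<And>k. g k \<in> M" "g \<longlonglongrightarrow> y"
    unfolding closure_sequential by blast
  then have "\<And>k. f k + g k \<in> M" "(\<lambda>k. f k + g k) \<longlonglongrightarrow> x + y"
    using complex_vector.subspace_add[OF assms] by (auto intro: tendsto_add)
  then show "x + y \<in> closure M"
    unfolding closure_sequential by (intro exI[of _ "\<lambda>k. f k + g k"] conjI allI)
next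
  fix c x assume "x \<in> closure M"
  then obtain f where "\<And>k. f k \<in> M" "f \<longlonglongrightarrow> x"
    unfolding closure_sequential by blast
  then have "\<And>k. c *\<^sub>C f k \<in> M" "(\<lambda>k. c *\<^sub>C f k) \<longlonglongrightarrow> c *\<^sub>C x"
    using complex_vector.subspace_scale[OF assms]
    by (auto intro: bounded_linear.tendsto[OF bounded_linear_scaleC])
  then show "c *\<^sub>C x \<in> closure M"
    unfolding closure_sequential by (intro exI[of _ "\<lambda>k. c *\<^sub>C f k"] conjI allI)
qed

lemma csubspace_range:
  assumes "T \<in> BH"
  shows "csubspace (range T)"
  unfolding complex_vector.subspace_def
proof (intro conjI ballI allI)
  have lin: "linear T" using assms by (simp add: BH_iff bounded_linear.linear)
  show "0 \<in> range T" by (rule range_eqI[of _ _ 0]) (simp add: linear_0[OF lin])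
  show "x + y \<in> range T" if "x \<in> range T" "y \<in> range T" for x y
    using that by (auto simp flip: linear_add[OF lin])
  show "c *\<^sub>C x \<in> range T" if "x \<in> range T" for c x
    using that by (auto simp flip: BH_scaleC[OF assms])
qed

text \<open>
  Extended by 0 on the orthogonal complement, a positive operator on \<open>M\<close> becomes a positive operator
  on the whole space. So roots on \<open>M\<close> reduce to roots on the whole space.
\<close>
lemma positive_on_extend:
  fixes M :: "'a :: complex_hilbert_space set"
  assumes M: "csubspace M" and closed: "closed M" and pos: "positive_on M Q"
  shows "Q \<circ> orth_proj M \<in> BH" "positive_operator (Q \<circ> orth_proj M)"
proof -
  note pos_iff = positive_on_iff[OF M closed] and P_in = orth_proj_in[OF M closed]
    and P_id = orth_proj_id[OF M closed] and P_sym = orth_proj_sym[OF M closed]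
  from pos have Q: "Q \<in> bounded_operators M" by (simp add: positive_on_def)
  show BH: "Q \<circ> orth_proj M \<in> BH" by (rule comp_orth_proj_BH[OF M closed Q])
  have move: "inner (Q (orth_proj M x)) y = inner (Q (orth_proj M x)) (orth_proj M y)" for x y
    using P_sym[of "Q (orth_proj M x)" y] bounded_operatorsD(1)[OF Q P_in] by (simp add: P_id)
  show "positive_operator (Q \<circ> orth_proj M)"
    unfolding positive_operator_def
  proof (intro conjI allI)
    show "bounded_linear (Q \<circ> orth_proj M)" by (rule BH_bounded_linear[OF BH])
    fix x y
    have "inner (Q (orth_proj M x)) (orth_proj M y) = inner (orth_proj M x) (Q (orth_proj M y))"
      using pos P_in pos_iff by blast
    then show "inner ((Q \<circ> orth_proj M) x) y = inner x ((Q \<circ> orth_proj M) y)"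
      using move[of x y] move[of y x] by (metis comp_apply inner_commute)
    have "0 \<le> inner (orth_proj M x) (Q (orth_proj M x))"
      using pos P_in pos_iff by blast
    then show "0 \<le> inner x ((Q \<circ> orth_proj M) x)"
      using move[of x x] by (metis comp_apply inner_commute)
  qed
qed

text \<open>
  Take the root \<open>R\<close> of the extension of \<open>T\<close>. It vanishes where the extension does, thus on the
  orthogonal complement of \<open>M\<close>; being symmetric, it has its range in \<open>M\<close> and restricts to a root
  on \<open>M\<close>. Two roots on \<open>M\<close> extend to two roots on the whole space, which agree.
\<close>
theorem sqrt_on_exists:
  fixes M :: "'a :: complex_hilbert_space set"
  assumes M: "csubspace M" and closed: "closed M" and T: "positive_on M T"
  shows "positive_on M (sqrt_on M T)" and "sqrt_on M T \<circ> sqrt_on M T = T"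
proof -
  note pos_iff = positive_on_iff[OF M closed] and P_in = orth_proj_in[OF M closed]
    and P_id = orth_proj_id[OF M closed] and P_sym = orth_proj_sym[OF M closed]
  note extend = positive_on_extend[OF M closed]
  have T_M: "T \<in> bounded_operators M" using T by (simp add: pos_iff)
  obtain R where R: "positive_operator R" "\<And>x. R (R x) = T (orth_proj M x)"
    "\<And>W x. bounded_linear W \<Longrightarrow> (\<And>x. W (T (orth_proj M x)) = T (orth_proj M (W x)))
      \<Longrightarrow> W (R x) = R (W x)"
    using positive_square_root[OF extend(2)[OF T]] unfolding o_def by metis
  have R_sym: "inner (R x) y = inner x (R y)" for x y
    using R(1) by (simp add: positive_operator_def)
  have R_scaleC: "R (c *\<^sub>C x) = c *\<^sub>C R x" for c x
    using BH_scaleC[OF extend(1)[OF T]]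
    by (intro R(3)[OF bounded_linear_scaleC, symmetric]) simp
  then have R_BH: "R \<in> BH"
    using R(1) by (simp add: BH_iff positive_operator_def)
  \<comment> \<open>\<open>R\<close> vanishes on the orthogonal complement of \<open>M\<close>, hence maps into \<open>M\<close>.\<close>
  have R_null: "R x = 0" if "orth_proj M x = 0" for x
  proof -
    have "inner (R x) (R x) = inner x (T (orth_proj M x))" by (simp only: R_sym R(2))
    also have "\<dots> = 0"
      using that bounded_linear.linear[OF BH_bounded_linear[OF extend(1)[OF T]]]
      by (metis comp_apply inner_zero_right linear_0 P_id complex_vector.subspace_0[OF M])
    finally show ?thesis by simp
  qed
  have R_M: "R x \<in> M" for x
  proof -
    define y where "y = R x - orth_proj M (R x)"
    have "orth_proj M y = 0"
      by (rule orth_proj_eqI[OF M closed complex_vector.subspace_0[OF M]])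
        (simp add: y_def orth_proj_orthogonal[OF M closed])
    then have "inner (R x) y = 0" by (simp add: R_sym R_null)
    moreover have "inner (orth_proj M (R x)) y = 0"
      using orth_proj_orthogonal[OF M closed P_in] by (simp add: y_def inner_commute)
    ultimately have "inner y y = 0" by (simp add: y_def inner_diff_left)
    then have "R x = orth_proj M (R x)" by (simp add: y_def)
    then show ?thesis using P_in by metis
  qed
  define R' where "R' = restrict_op R M"
  have R'_pos: "positive_on M R'"
    unfolding pos_iff
  proof (intro conjI ballI)
    show "R' \<in> bounded_operators M"
      using bounded_operatorsD[OF R_BH] bounded_operators_bound[OF R_BH] R_M M
      by (auto simp: bounded_operators_def R'_def restrict_op_def complex_vector.subspace_add
          complex_vector.subspace_scale)
  next
    show "inner (R' x) y = inner x (R' y)" if "x \<in> M" "y \<in> M" for x y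
      using that by (simp add: R'_def restrict_op_def R_sym)
    show "0 \<le> inner x (R' x)" if "x \<in> M" for x
      using that R(1) by (simp add: R'_def restrict_op_def positive_operator_def)
  qed
  have R'_sq: "R' \<circ> R' = T"
    using R_M bounded_operatorsD(4)[OF T_M] complex_vector.subspace_0[OF M]
      bounded_linear.linear[OF BH_bounded_linear[OF R_BH]]
    by (auto simp: fun_eq_iff R'_def restrict_op_def R(2) P_id linear_0)
  have unique: "Q = R'" if Q: "positive_on M Q" and Q_sq: "Q \<circ> Q = T" for Q
  proof
    fix x
    have BO: "Q \<in> bounded_operators M" "R' \<in> bounded_operators M"
      using Q R'_pos by (simp_all add: positive_on_def)
    have in_M: "Q (orth_proj M x) \<in> M" "R' (orth_proj M x) \<in> M" for x
      by (rule BO[THEN bounded_operatorsD(1), OF P_in])+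
    have "Q \<circ> orth_proj M = R' \<circ> orth_proj M"
      using Q_sq R'_sq in_M
      by (intro positive_square_root_unique extend Q R'_pos) (auto simp: P_id fun_eq_iff)
    then have "Q x = R' x" if "x \<in> M" using that by (metis P_id comp_apply)
    moreover have "Q x = R' x" if "x \<notin> M"
      using BO[THEN bounded_operatorsD(4), OF that] by simp
    ultimately show "Q x = R' x" by blast
  qed
  have "sqrt_on M T = R'"
    unfolding sqrt_on_def by (rule the_equality) (use R'_pos R'_sq unique in blast)+
  then show "positive_on M (sqrt_on M T)" "sqrt_on M T \<circ> sqrt_on M T = T"
    using R'_pos R'_sq by simp_all
qed

section \<open>Powers of \<open>\<triangle>\<close> and \<open>\<delta>\<close>\<close>

lemma elem_power_zero:
  assumes d: "d \<in> {elem_tri, elem_delta}" and T: "\<And>x y. T (x - y) = T x - T y"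
  shows "(d T S ^^ j) (\<lambda>_. 0) = (\<lambda>_. 0)"
proof -
  have "T 0 = 0" using T[of 0 0] by simp
  then have "d T S (\<lambda>_. 0) = (\<lambda>_. 0)"
    using d by (auto simp: elem_tri_def elem_delta_def)
  then show ?thesis by (induction j) simp_all
qed

text \<open>
  If \<open>V\<close> intertwines the left operators and \<open>W\<close> the right ones, then \<open>X \<mapsto> V X W\<close> intertwines the two
  maps \<open>d\<close>, whichever of \<open>\<triangle>\<close> and \<open>\<delta>\<close> they are, and hence their powers.
\<close>
lemma elem_power_intertwine:
  assumes d: "d \<in> {elem_tri, elem_delta}" and V: "\<And>x y. V (x - y) = V x - V y"
    and T: "\<And>x. V (T' x) = T (V x)" and S: "\<And>x. S' (W x) = W (S x)"
  shows "(d T S ^^ j) (V \<circ> X \<circ> W) = V \<circ> (d T' S' ^^ j) X \<circ> W"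
proof (induction j)
  case (Suc j)
  have step: "d T S (V \<circ> Y \<circ> W) = V \<circ> d T' S' Y \<circ> W" for Y
    using d by (auto simp: elem_tri_def elem_delta_def fun_eq_iff V T S)
  have "(d T S ^^ Suc j) (V \<circ> X \<circ> W) = d T S ((d T S ^^ j) (V \<circ> X \<circ> W))" by simp
  also have "\<dots> = V \<circ> d T' S' ((d T' S' ^^ j) X) \<circ> W" unfolding Suc.IH by (rule step)
  also have "\<dots> = V \<circ> (d T' S' ^^ Suc j) X \<circ> W" by simp
  finally show ?case .
qed simp

lemma elem_power_add:
  assumes d: "d \<in> {elem_tri, elem_delta}" and T: "\<And>x y. T (x + y) = T x + T y"
  shows "(d T S ^^ j) (\<lambda>x. X x + Y x) = (\<lambda>x. (d T S ^^ j) X x + (d T S ^^ j) Y x)"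
  using d by (induction j) (auto simp: elem_tri_def elem_delta_def fun_eq_iff T)

text \<open>
  In the commutative algebra generated by the left multiplication \<open>l\<close> by \<open>T\<close> and the right
  multiplication \<open>r\<close> by \<open>S\<close>, the map \<open>d\<close> for the powers is a multiple of the map \<open>d\<close> for the pair
  itself, as \<open>l\<^sup>n r\<^sup>n - 1\<close> is a multiple of \<open>l r - 1\<close> and \<open>l\<^sup>n - r\<^sup>n\<close> one of \<open>l - r\<close>. The proof avoids
  naming the quotient: by a telescoping step from \<open>n\<close> to \<open>n + 1\<close>, each application of \<open>d\<close> for the
  powers saves one application of \<open>d\<close> for the pair.
\<close>
lemma elem_power_of_powers:
  fixes T S X :: "'a :: complex_hilbert_space \<Rightarrow> 'a"
  assumes d: "d \<in> {elem_tri, elem_delta}" and T: "linear T"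
    and X: "(d T S ^^ m) X = (\<lambda>_. 0)"
  shows "(d (T ^^ n) (S ^^ n) ^^ m) X = (\<lambda>_. 0)"
proof -

  note add = elem_power_add[OF d linear_add[OF T]]
  note inter = elem_power_intertwine[OF d]
  have drop: "(d T S ^^ j) (d (T ^^ n) (S ^^ n) X) = (\<lambda>_. 0)"
    if X: "(d T S ^^ Suc j) X = (\<lambda>_. 0)" for j n X
  proof (induction n)
    case 0
    have "d (T ^^ 0) (S ^^ 0) X = (\<lambda>_. 0)"
      using d by (auto simp: elem_tri_def elem_delta_def)
    then show ?case by (simp only: elem_power_zero[OF d linear_diff[OF T]])
  next
    case (Suc n)
    let ?D = "d (T ^^ n) (S ^^ n) X"
    have dX: "(d T S ^^ j) (d T S X) = (\<lambda>_. 0)" using X by (simp add: funpow_swap1)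
    have T0: "T 0 = 0" by (rule linear_0[OF T])
    consider "d = elem_tri" | "d = elem_delta" using d by blast
    then show ?case
    proof cases
      case 1
      have "d (T ^^ Suc n) (S ^^ Suc n) X = (\<lambda>x. (T \<circ> ?D \<circ> S) x + d T S X x)"
        by (auto simp: 1 elem_tri_def linear_diff[OF T] fun_eq_iff funpow_swap1)
      moreover have "(d T S ^^ j) (T \<circ> ?D \<circ> S) = T \<circ> (d T S ^^ j) ?D \<circ> S"
        by (rule inter[where V = T and W = S]) (simp_all add: linear_diff[OF T])
      then have "(d T S ^^ j) (T \<circ> ?D \<circ> S) = (\<lambda>_. 0)"
        unfolding Suc.IH by (simp add: o_def T0)
      ultimately show ?thesis by (simp only: add dX) simp
    next
      case 2
      have "d (T ^^ Suc n) (S ^^ Suc n) X = (\<lambda>x. (T \<circ> ?D \<circ> id) x + (id \<circ> d T S X \<circ> (S ^^ n)) x)"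
        by (auto simp: 2 elem_delta_def linear_diff[OF T] fun_eq_iff funpow_swap1)
      moreover have "(d T S ^^ j) (T \<circ> ?D \<circ> id) = T \<circ> (d T S ^^ j) ?D \<circ> id"
        by (rule inter[where V = T and W = id]) (simp_all add: linear_diff[OF T])
      then have "(d T S ^^ j) (T \<circ> ?D \<circ> id) = (\<lambda>_. 0)"
        unfolding Suc.IH by (simp add: o_def T0)
      moreover have "(d T S ^^ j) (id \<circ> d T S X \<circ> (S ^^ n)) = id \<circ> (d T S ^^ j) (d T S X) \<circ> (S ^^ n)"
        by (rule inter[where V = id and W = "S ^^ n"]) (simp_all add: funpow_swap1)
      then have "(d T S ^^ j) (id \<circ> d T S X \<circ> (S ^^ n)) = (\<lambda>_. 0)"
        unfolding dX by (simp add: o_def)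
      ultimately show ?thesis by (simp only: add) simp
    qed
  qed
  show ?thesis
    using X
  proof (induction m arbitrary: X)
    case (Suc m)
    from Suc.IH[OF drop[OF Suc.prems]] show ?case by (simp add: funpow_swap1)
  qed simp
qed

lemma elem_power_BH:
  assumes "d \<in> {elem_tri, elem_delta}" "T \<in> BH" "S \<in> BH" "X \<in> BH"
  shows "(d T S ^^ j) X \<in> BH"
proof (induction j)
  case (Suc j)
  have "d T S Y \<in> BH" if "Y \<in> BH" for Y
    using assms(1)
      BH_diff[OF BH_comp[OF assms(2) BH_comp[OF that assms(3)]] that]
      BH_diff[OF BH_comp[OF assms(2) that] BH_comp[OF that assms(3)]]
    by (auto simp: elem_tri_def elem_delta_def o_def)
  with Suc show ?case by simp
qed (simp add: assms)

section \<open>Passing from \<open>S\<close> to \<open>A\<close>\<close>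

text \<open>
  The orthogonal complement of the range of a symmetric operator is its kernel.
\<close>
lemma self_adjoint_dense_range:
  fixes R :: "'a :: complex_hilbert_space \<Rightarrow> 'a"
  assumes R: "R \<in> BH" and sym: "\<And>x y. inner (R x) y = inner x (R y)" and inj: "\<And>x. R x = 0 \<Longrightarrow> x = 0"
  shows "closure (range R) = UNIV"
proof -
  have "y \<in> closure (range R)" for y
  proof -
    have "subspace (closure (range R))"
      by (rule csubspace_imp_subspace[OF csubspace_closure[OF csubspace_range[OF R]]])
    then obtain u where u: "u \<in> closure (range R)"
      "\<And>w. w \<in> closure (range R) \<Longrightarrow> inner (y - u) w = 0"
      using orthogonal_projection_exists[of "closure (range R)" y] by auto
    have "inner (R (y - u)) (R (y - u)) = inner (y - u) (R (R (y - u)))" by (rule sym)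
    also have "\<dots> = 0" by (rule u(2)[OF subsetD[OF closure_subset]]) simp
    finally have "R (y - u) = 0" by simp
    then have "y - u = 0" by (rule inj)
    with u(1) show ?thesis by simp
  qed
  then show ?thesis by blast
qed

lemma adj_funpow_inner:
  assumes "S \<in> BH"
  shows "inner ((S ^^ n) x) y = inner x ((adj S ^^ n) y)"
  by (induction n arbitrary: x y) (simp_all add: BH_adj(2)[OF assms] funpow_swap1)

text \<open>
  The common core of the three parts. By hypothesis and \<open>elem_power_of_powers\<close>, the map
  \<open>d\<^sup>m\<close> for the pair \<open>(S\<^sup>*\<^sup>n, S\<^sup>n)\<close> kills \<open>S\<^sup>*\<^sup>n S\<^sup>n = P Q P\<close>. Since \<open>A P = P S\<^sup>n\<close> and, taking
  adjoints, \<open>P A\<^sup>* = S\<^sup>*\<^sup>n P\<close>, the result equals \<open>P d\<^sup>m(Q) P\<close> with \<open>d\<close> now formed for \<open>(A\<^sup>*, A)\<close>.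
  An injective \<open>P\<close> cancels on the left, and on the right because its range is dense.
\<close>
lemma transported_defect_zero:
  fixes S A P Q :: "'a :: complex_hilbert_space \<Rightarrow> 'a"
  assumes d: "d \<in> {elem_tri, elem_delta}" and S: "S \<in> BH"
    and hyp: "(adj S ^^ n) \<circ> (d (adj S) S ^^ m) id \<circ> (S ^^ n) = (\<lambda>_. 0)"
    and P: "P \<in> BH" and P_sym: "\<And>x y. inner (P x) y = inner x (P y)"
    and P_inj: "\<And>x. P x = 0 \<Longrightarrow> x = 0"
    and A: "A \<in> BH" "\<And>x. A (P x) = P ((S ^^ n) x)"
    and Q: "Q \<in> BH" "\<And>x. P (Q (P x)) = (adj S ^^ n) ((S ^^ n) x)"
  shows "(d (adj A) A ^^ m) Q = (\<lambda>_. 0)"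
proof -
  have adj_lin: "linear (adj S)"
    using BH_adj(1)[OF S] by (simp add: BH_iff bounded_linear.linear)
  have pow_lin: "linear (adj S ^^ n)"
    using BH_funpow[OF BH_adj(1)[OF S]] by (simp add: BH_iff bounded_linear.linear)
  have P_lin: "linear P" using P by (simp add: BH_iff bounded_linear.linear)
  have "(d (adj S) S ^^ m) ((adj S ^^ n) \<circ> id \<circ> (S ^^ n))
      = (adj S ^^ n) \<circ> (d (adj S) S ^^ m) id \<circ> (S ^^ n)"
    by (rule elem_power_intertwine[OF d, where V = "adj S ^^ n" and W = "S ^^ n"])
      (auto simp: linear_diff[OF pow_lin] funpow_swap1)
  then have "(d (adj S) S ^^ m) ((adj S ^^ n) \<circ> id \<circ> (S ^^ n)) = (\<lambda>_. 0)"
    by (simp only: hyp)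
  then have "(d (adj S ^^ n) (S ^^ n) ^^ m) ((adj S ^^ n) \<circ> id \<circ> (S ^^ n)) = (\<lambda>_. 0)"
    by (rule elem_power_of_powers[where T = "adj S" and S = S and m = m, OF d adj_lin])
  also have "(adj S ^^ n) \<circ> id \<circ> (S ^^ n) = P \<circ> Q \<circ> P" by (simp add: fun_eq_iff Q)
  also have "(d (adj S ^^ n) (S ^^ n) ^^ m) (P \<circ> Q \<circ> P) = P \<circ> (d (adj A) A ^^ m) Q \<circ> P"
  proof (rule elem_power_intertwine[OF d, where V = P and W = P])
    show "P (adj A y) = (adj S ^^ n) (P y)" for y
    proof (rule vector_eq_ldot[THEN iffD1, rule_format])
      fix x
      have "inner x (P (adj A y)) = inner (A (P x)) y"
        by (simp add: BH_adj(2)[OF A(1)] flip: P_sym)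
      also have "\<dots> = inner x ((adj S ^^ n) (P y))"
        by (simp add: A(2) P_sym adj_funpow_inner[OF S])
      finally show "inner x (P (adj A y)) = inner x ((adj S ^^ n) (P y))" .
    qed
  qed (simp_all add: linear_diff[OF P_lin] A)
  finally have zero: "(d (adj A) A ^^ m) Q (P x) = 0" for x
    by (intro P_inj[of "(d (adj A) A ^^ m) Q (P x)"]) (metis comp_apply)
  have "(d (adj A) A ^^ m) Q \<in> BH"
    by (rule elem_power_BH[OF d BH_adj(1)[OF A(1)] A(1) Q(1)])
  then have "continuous_on UNIV ((d (adj A) A ^^ m) Q)"
    by (simp add: BH_iff linear_continuous_on)
  then have "closed {y. (d (adj A) A ^^ m) Q y = 0}"
    by (intro closed_Collect_eq continuous_on_const)
  then have "closure (range P) \<subseteq> {y. (d (adj A) A ^^ m) Q y = 0}"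
    using zero by (intro closure_minimal) auto
  moreover have "closure (range P) = UNIV" by (rule self_adjoint_dense_range[OF P P_sym P_inj])
  ultimately show ?thesis by auto
qed

section \<open>The operator \<open>P\<close>\<close>

lemma BH_add: "S \<in> BH \<Longrightarrow> T \<in> BH \<Longrightarrow> (\<lambda>x. S x + T x) \<in> BH"
  by (auto simp: BH_iff bounded_linear_add scaleC_add_right)

lemma bounded_operators_comp:
  assumes A: "A \<in> bounded_operators M" and B: "B \<in> bounded_operators M" and M: "csubspace M"
  shows "A \<circ> B \<in> bounded_operators M"
proof -
  have A0: "A 0 = 0"
    using bounded_operatorsD(3)[OF A complex_vector.subspace_0[OF M], of 0] by simp
  obtain K where K: "K \<ge> 0" "\<forall>x\<in>M. norm (A x) \<le> K * norm x"
    using bounded_operators_bound[OF A] by blast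
  obtain L where L: "L \<ge> 0" "\<forall>x\<in>M. norm (B x) \<le> L * norm x"
    using bounded_operators_bound[OF B] by blast
  have "norm (A (B x)) \<le> (K * L) * norm x" if "x \<in> M" for x
    using bspec[OF K(2) bounded_operatorsD(1)[OF B that]]
      mult_left_mono[OF bspec[OF L(2) that] K(1)]
    by (simp add: mult.assoc)
  then have "\<exists>K. \<forall>x\<in>M. norm (A (B x)) \<le> K * norm x" by blast
  then show ?thesis
    by (simp add: bounded_operators_def bounded_operatorsD[OF A] bounded_operatorsD[OF B] A0)
qed

lemma bounded_operators_funpow:
  assumes "A \<in> bounded_operators M" "csubspace M" "n \<ge> 1"
  shows "A ^^ n \<in> bounded_operators M"
  using assms(3)
proof (induction n rule: dec_induct)
  case base
  then show ?case using assms(1) by (simp add: eta_contract_eq)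
next
  case (step k)
  from bounded_operators_comp[OF assms(1) step.IH assms(2)] show ?case by (simp only: funpow.simps)
qed

context
  fixes S :: "'a :: complex_hilbert_space \<Rightarrow> 'a" and n :: nat
  assumes S: "S \<in> BH" and n: "n \<ge> 1"
begin

lemma range_closure_csubspace: "csubspace (range_closure n S)"
  unfolding range_closure_def by (intro csubspace_closure csubspace_range BH_funpow S)

lemma range_closure_closed: "closed (range_closure n S)"
  by (simp add: range_closure_def)

lemma range_closure_invariant:
  assumes "x \<in> range_closure n S"
  shows "S x \<in> range_closure n S"
proof -
  have "S ` range (S ^^ n) \<subseteq> range (S ^^ n)"
    by (auto simp: funpow_swap1)
  moreover have "S ` closure (range (S ^^ n)) \<subseteq> closure (S ` range (S ^^ n))"
    using S by (intro image_closure_subset closed_closure closure_subset)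
      (simp add: BH_iff linear_continuous_on)
  ultimately show ?thesis
    using assms closure_mono unfolding range_closure_def by blast
qed

lemma adj_kernel_iff: "x \<in> adj_kernel n S \<longleftrightarrow> orth_proj (range_closure n S) x = 0"
proof -
  have "x \<in> adj_kernel n S \<longleftrightarrow> (\<forall>y. inner ((S ^^ n) y) x = 0)"
    unfolding adj_kernel_def adj_funpow_inner[OF S]
    using vector_eq_ldot[of "(adj S ^^ n) x" 0] by simp
  also have "\<dots> \<longleftrightarrow> (\<forall>w\<in>range_closure n S. inner w x = 0)"
  proof
    assume "\<forall>y. inner ((S ^^ n) y) x = 0"
    then have "range (S ^^ n) \<subseteq> {w. inner w x = 0}" by auto
    moreover have "closed {w. inner w x = 0}"
      by (intro closed_Collect_eq continuous_intros)
    ultimately show "\<forall>w\<in>range_closure n S. inner w x = 0"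
      unfolding range_closure_def by (meson closure_minimal subsetD mem_Collect_eq)
  next
    assume *: "\<forall>w\<in>range_closure n S. inner w x = 0"
    have "(S ^^ n) y \<in> range_closure n S" for y
      unfolding range_closure_def by (rule subsetD[OF closure_subset rangeI])
    with * show "\<forall>y. inner ((S ^^ n) y) x = 0" by blast
  qed
  also have "\<dots> \<longleftrightarrow> orth_proj (range_closure n S) x = 0"
  proof
    assume "\<forall>w\<in>range_closure n S. inner w x = 0"
    then show "orth_proj (range_closure n S) x = 0"
      by (intro orth_proj_eqI range_closure_csubspace range_closure_closed
          complex_vector.subspace_0) (auto simp: inner_commute)
  next
    assume "orth_proj (range_closure n S) x = 0"
    then show "\<forall>w\<in>range_closure n S. inner w x = 0"
      using orth_proj_orthogonal[OF range_closure_csubspace range_closure_closed, of _ x]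
      by (simp add: inner_commute)
  qed
  finally show ?thesis .
qed

text \<open>
  \<open>P\<^sub>1\<close> is the root of the Gram operator of \<open>S\<^sub>1\<^sup>n\<close>, whence \<open>\<parallel>P\<^sub>1 u\<parallel> = \<parallel>S\<^sup>n u\<parallel>\<close>.
\<close>
lemma polar_part_properties:
  shows "positive_on (range_closure n S) (polar_part n S)"
    and "u \<in> range_closure n S \<Longrightarrow> norm (polar_part n S u) = norm ((S ^^ n) u)"
proof -
  define M where "M = range_closure n S"
  define S1 where "S1 = restrict_op S M"
  define A where "A = adjoint_on M S1"
  have M: "csubspace M" "closed M"
    by (simp_all add: M_def range_closure_csubspace range_closure_closed)
  have S1: "S1 \<in> bounded_operators M"
  proof -
    have "\<exists>K. \<forall>x\<in>M. norm (S x) \<le> K * norm x"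
      using bounded_operators_bound[OF S] by blast
    then show ?thesis
      using range_closure_invariant
      by (simp add: bounded_operators_def S1_def restrict_op_def bounded_operatorsD(2,3)[OF S]
          complex_vector.subspace_add[OF M(1)] complex_vector.subspace_scale[OF M(1)] flip: M_def)
  qed
  note A = adjoint_on_exists[OF M S1, folded A_def]
  have pow: "(S1 ^^ k) u \<in> M" "(S1 ^^ k) u = (S ^^ k) u" "(A ^^ k) u \<in> M" if "u \<in> M" for k u
  proof -
    show in_M: "(S1 ^^ k) u \<in> M" for k
      by (induction k) (simp_all add: that bounded_operatorsD(1)[OF S1])
    show "(A ^^ k) u \<in> M"
      by (induction k) (simp_all add: that bounded_operatorsD(1)[OF A(1)])
    show "(S1 ^^ k) u = (S ^^ k) u"
    proof (induction k)
      case (Suc k)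
      then show ?case using in_M[of k] by (simp add: S1_def restrict_op_def)
    qed simp
  qed
  have pow_adj: "inner ((S1 ^^ k) x) y = inner x ((A ^^ k) y)" if "x \<in> M" "y \<in> M" for k x y
    using that
  proof (induction k arbitrary: x y)
    case (Suc k)
    have "inner ((S1 ^^ Suc k) x) y = inner ((S1 ^^ k) x) (A y)"
      using A(2)[OF pow(1)[OF Suc.prems(1)] Suc.prems(2)] by simp
    also have "\<dots> = inner x ((A ^^ k) (A y))"
      by (intro Suc.IH Suc.prems bounded_operatorsD(1)[OF A(1)])
    finally show ?case by (simp add: funpow_swap1)
  qed simp
  have gram: "inner x ((A ^^ n \<circ> S1 ^^ n) y) = inner ((S ^^ n) x) ((S ^^ n) y)"
    if "x \<in> M" "y \<in> M" for x y
    using pow_adj[OF that(1) pow(1)[OF that(2)], of n n] that by (simp add: pow(2))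
  have T: "positive_on M (A ^^ n \<circ> S1 ^^ n)"
    unfolding positive_on_iff[OF M]
  proof (intro conjI ballI)
    show "A ^^ n \<circ> S1 ^^ n \<in> bounded_operators M"
      by (intro bounded_operators_comp bounded_operators_funpow M n A S1)
    show "inner ((A ^^ n \<circ> S1 ^^ n) x) y = inner x ((A ^^ n \<circ> S1 ^^ n) y)"
      if "x \<in> M" "y \<in> M" for x y
      using gram[OF that] gram[OF that(2,1)] by (metis inner_commute)
    show "0 \<le> inner x ((A ^^ n \<circ> S1 ^^ n) x)" if "x \<in> M" for x
      by (simp only: gram[OF that that] inner_ge_zero)
  qed
  have P1: "polar_part n S = sqrt_on M (A ^^ n \<circ> S1 ^^ n)"
    by (simp add: polar_part_def Let_def M_def S1_def A_def)
  note sqrt = sqrt_on_exists[OF M T, folded P1]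
  from sqrt(1) show "positive_on (range_closure n S) (polar_part n S)" by (simp add: M_def)
  show "norm (polar_part n S u) = norm ((S ^^ n) u)" if "u \<in> range_closure n S"
  proof -
    have u: "u \<in> M" using that by (simp add: M_def)
    have "polar_part n S u \<in> M"
      using sqrt(1) bounded_operatorsD(1)[OF _ u] by (auto simp: positive_on_def)
    then have "inner (polar_part n S u) (polar_part n S u)
        = inner u ((polar_part n S \<circ> polar_part n S) u)"
      using sqrt(1) u unfolding positive_on_iff[OF M] by (metis comp_apply)
    also have "\<dots> = inner ((S ^^ n) u) ((S ^^ n) u)"
      unfolding sqrt(2) by (rule gram[OF u u])
    finally show ?thesis by (simp add: norm_eq_sqrt_inner)
  qed
qed

lemma polar_sum_eq:
  "polar_sum n S x = polar_part n S (orth_proj (range_closure n S) x)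
     + (x - orth_proj (range_closure n S) x)"
proof -
  define \<pi> where "\<pi> = orth_proj (range_closure n S)"
  note proj = orth_proj_id[OF range_closure_csubspace range_closure_closed, folded \<pi>_def]
    orth_proj_in[OF range_closure_csubspace range_closure_closed, folded \<pi>_def]
  have lin: "linear \<pi>"
    using orth_proj_BH[OF range_closure_csubspace range_closure_closed]
    by (simp add: \<pi>_def BH_iff bounded_linear.linear)
  have ker: "v \<in> adj_kernel n S \<longleftrightarrow> \<pi> v = 0" for v
    by (simp add: adj_kernel_iff \<pi>_def)
  have "polar_sum n S x = polar_part n S (\<pi> x) + (x - \<pi> x)"
    unfolding polar_sum_def direct_sum_op_def
  proof (rule the_equality)
    have "x - \<pi> x \<in> adj_kernel n S" by (simp add: ker linear_diff[OF lin] proj)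
    then show "\<exists>u\<in>range_closure n S. \<exists>v\<in>adj_kernel n S. x = u + v \<and>
        polar_part n S (\<pi> x) + (x - \<pi> x) = polar_part n S u + restrict_op id (adj_kernel n S) v"
      by (intro bexI[of _ "\<pi> x"] bexI[of _ "x - \<pi> x"]) (auto simp: restrict_op_def proj)
  next
    fix z assume "\<exists>u\<in>range_closure n S. \<exists>v\<in>adj_kernel n S. x = u + v \<and>
        z = polar_part n S u + restrict_op id (adj_kernel n S) v"
    then obtain u v where uv: "u \<in> range_closure n S" "v \<in> adj_kernel n S" "x = u + v"
      "z = polar_part n S u + restrict_op id (adj_kernel n S) v" by blast
    then have "\<pi> x = u" by (simp add: linear_add[OF lin] proj ker)
    with uv show "z = polar_part n S (\<pi> x) + (x - \<pi> x)" by (simp add: restrict_op_def)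
  qed
  then show ?thesis by (simp add: \<pi>_def)
qed

text \<open>
  The kernel of \<open>S\<^sup>*\<^sup>n\<close> is the orthogonal complement of the closure of the range of \<open>S\<^sup>n\<close>,
  so \<open>P\<close> is an orthogonal sum of self-adjoint operators and Pythagoras computes its norm.
\<close>
lemma polar_sum_properties:
  shows "polar_sum n S \<in> BH"
    and "inner (polar_sum n S x) y = inner x (polar_sum n S y)"
    and "(norm (polar_sum n S x))\<^sup>2 = (norm ((S ^^ n) (orth_proj (range_closure n S) x)))\<^sup>2
           + (norm (x - orth_proj (range_closure n S) x))\<^sup>2"
proof -
  note M = range_closure_csubspace range_closure_closed
  define \<pi> where "\<pi> = orth_proj (range_closure n S)"
  note P1 = polar_part_properties
  note ext = positive_on_extend[OF M P1(1), folded \<pi>_def]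
  have eq: "polar_sum n S = (\<lambda>x. (polar_part n S \<circ> \<pi>) x + (x - \<pi> x))"
    by (simp add: polar_sum_eq \<pi>_def fun_eq_iff)
  have "(\<lambda>x. id x - \<pi> x) \<in> BH"
    unfolding \<pi>_def by (intro BH_diff BH_id orth_proj_BH M)
  then show "polar_sum n S \<in> BH"
    unfolding eq by (intro BH_add ext(1)) simp
  have "inner ((polar_part n S \<circ> \<pi>) x) y = inner x ((polar_part n S \<circ> \<pi>) y)"
    using ext(2) by (simp only: positive_operator_def)
  moreover have "inner (\<pi> x) y = inner x (\<pi> y)"
    unfolding \<pi>_def by (rule orth_proj_sym[OF M])
  ultimately show "inner (polar_sum n S x) y = inner x (polar_sum n S y)"
    unfolding eq by (simp add: inner_add_left inner_add_right inner_diff_left inner_diff_right)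
  have in_M: "\<pi> x \<in> range_closure n S" unfolding \<pi>_def by (rule orth_proj_in[OF M])
  have "polar_part n S (\<pi> x) \<in> range_closure n S"
    using P1(1) bounded_operatorsD(1)[OF _ in_M] by (auto simp: positive_on_def)
  then have "orthogonal (polar_part n S (\<pi> x)) (x - \<pi> x)"
    using orth_proj_orthogonal[OF M, of _ x]
    by (subst orthogonal_commute) (simp add: orthogonal_def \<pi>_def)
  then have "(norm (polar_sum n S x))\<^sup>2 = (norm (polar_part n S (\<pi> x)))\<^sup>2 + (norm (x - \<pi> x))\<^sup>2"
    unfolding eq by (simp add: norm_add_Pythagorean)
  then show "(norm (polar_sum n S x))\<^sup>2 = (norm ((S ^^ n) (orth_proj (range_closure n S) x)))\<^sup>2
      + (norm (x - orth_proj (range_closure n S) x))\<^sup>2"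
    using P1(2)[OF in_M] by (simp add: \<pi>_def)
qed

end

section \<open>Factoring through an operator with dense range\<close>

text \<open>
  The case of Douglas' factorisation lemma needed here: if \<open>\<parallel>T x\<parallel> \<le> C \<parallel>P x\<parallel>\<close>, then \<open>P x \<mapsto> T x\<close> is a
  well-defined Lipschitz map on the range of \<open>P\<close>, and extends by continuity to its closure. With
  \<open>T = I\<close> it inverts an operator which is bounded below.
\<close>
lemma factor_through_dense_range:
  fixes P T :: "'a :: complex_hilbert_space \<Rightarrow> 'a"
  assumes P: "P \<in> BH" and dense: "closure (range P) = UNIV" and T: "T \<in> BH"
    and dom: "\<And>x. norm (T x) \<le> C * norm (P x)"
  obtains W where "W \<in> BH" "\<And>x. W (P x) = T x"
proof -
  have P_lin: "linear P" and T_lin: "linear T"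
    using P T by (simp_all add: BH_iff bounded_linear.linear)
  have dom_diff: "norm (T x - T y) \<le> \<bar>C\<bar> * norm (P x - P y)" for x y
    using order.trans[OF dom[of "x - y"] mult_right_mono[of C "\<bar>C\<bar>"]]
    by (simp add: linear_diff[OF P_lin] linear_diff[OF T_lin])
  define g where "g = (\<lambda>y. T (inv P y))"
  have g: "g (P x) = T x" for x
  proof -
    have "P (inv P (P x)) = P x" by (rule f_inv_into_f) simp
    then show ?thesis using dom_diff[of "inv P (P x)" x] by (simp add: g_def)
  qed
  have "\<bar>C\<bar>-lipschitz_on (range P) g"
    by (rule lipschitz_onI) (auto simp: g dist_norm dom_diff)
  then have "uniformly_continuous_on (range P) g"
    by (rule lipschitz_on_uniformly_continuous)
  then obtain W where "uniformly_continuous_on (closure (range P)) W"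
    and W_g: "\<And>y. y \<in> range P \<Longrightarrow> g y = W y"
    by (rule uniformly_continuous_on_extension_on_closure) blast
  then have cont: "continuous_on UNIV W"
    by (simp add: dense uniformly_continuous_imp_continuous)
  have WP: "W (P x) = T x" for x using W_g[of "P x"] by (simp add: g)
  have seq: "\<exists>a. (\<lambda>k. P (a k)) \<longlonglongrightarrow> x \<and> (\<lambda>k. T (a k)) \<longlonglongrightarrow> W x" for x
  proof -
    have "x \<in> closure (range P)" by (simp add: dense)
    then obtain b where b: "\<And>k. b k \<in> range P" "b \<longlonglongrightarrow> x"
      unfolding closure_sequential by blast
    define a where "a = (\<lambda>k. inv P (b k))"
    have "P (a k) = b k" for k unfolding a_def by (rule f_inv_into_f[OF b(1)])
    then have lim: "(\<lambda>k. P (a k)) \<longlonglongrightarrow> x" using b(2) by simp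
    have "isCont W x" using cont by (simp add: continuous_on_eq_continuous_at)
    then have "(\<lambda>k. W (P (a k))) \<longlonglongrightarrow> W x" using lim by (rule isCont_tendsto_compose)
    with lim show ?thesis by (auto simp: WP)
  qed
  have W_eqI: "W x = y" if "(\<lambda>k. P (a k)) \<longlonglongrightarrow> x" "(\<lambda>k. T (a k)) \<longlonglongrightarrow> y" for a x y
  proof -
    have "isCont W x" using cont by (simp add: continuous_on_eq_continuous_at)
    then have "(\<lambda>k. W (P (a k))) \<longlonglongrightarrow> W x" using that(1) by (rule isCont_tendsto_compose)
    then show ?thesis using that(2) LIMSEQ_unique by (simp add: WP) blast
  qed
  have add: "W (x + y) = W x + W y" for x y
  proof -
    obtain a b where "(\<lambda>k. P (a k)) \<longlonglongrightarrow> x" "(\<lambda>k. T (a k)) \<longlonglongrightarrow> W x"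
      "(\<lambda>k. P (b k)) \<longlonglongrightarrow> y" "(\<lambda>k. T (b k)) \<longlonglongrightarrow> W y"
      using seq by meson
    then show ?thesis
      by (intro W_eqI[of "\<lambda>k. a k + b k"])
        (simp_all add: linear_add[OF P_lin] linear_add[OF T_lin] tendsto_add)
  qed
  have scale: "W (c *\<^sub>C x) = c *\<^sub>C W x" for c x
  proof -
    obtain a where "(\<lambda>k. P (a k)) \<longlonglongrightarrow> x" "(\<lambda>k. T (a k)) \<longlonglongrightarrow> W x"
      using seq by meson
    then show ?thesis
      by (intro W_eqI[of "\<lambda>k. c *\<^sub>C a k"])
        (simp_all add: BH_scaleC[OF P] BH_scaleC[OF T]
          bounded_linear.tendsto[OF bounded_linear_scaleC])
  qed
  have bound: "norm (W x) \<le> C * norm x" for x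
  proof -
    obtain a where a: "(\<lambda>k. P (a k)) \<longlonglongrightarrow> x" "(\<lambda>k. T (a k)) \<longlonglongrightarrow> W x"
      using seq by meson
    show ?thesis
      by (rule LIMSEQ_le[OF tendsto_norm[OF a(2)] tendsto_mult_left[OF tendsto_norm[OF a(1)]]])
        (use dom in blast)
  qed
  have "W \<in> BH"
    unfolding bounded_operators_def using add scale bound by blast
  with WP show thesis by (rule that[rotated])
qed

theorem proposition2p2:
  fixes S P :: "'a :: complex_hilbert_space \<Rightarrow> 'a"
    and d :: "('a \<Rightarrow> 'a) \<Rightarrow> ('a \<Rightarrow> 'a) \<Rightarrow> ('a \<Rightarrow> 'a) \<Rightarrow> ('a \<Rightarrow> 'a)"
    and m n :: nat
  assumes "infinite_dimensional TYPE('a)"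
    and "m \<ge> 1" and "n \<ge> 1"
    and "d \<in> {elem_tri, elem_delta}"
    and "S \<in> BH"
    and "(adj S ^^ n) \<circ> (d (adj S) S ^^ m) id \<circ> (S ^^ n) = (\<lambda>_. 0)"
    and "P = polar_sum n S"
  shows "(d = elem_tri \<longrightarrow>
            (\<exists>Q\<in>BH. \<exists>A\<in>BH. positive_on UNIV Q \<and>
               (elem_tri (adj A) A ^^ m) Q = (\<lambda>_. 0) \<and> similar (S ^^ n) A))
       \<and> (d = elem_delta \<and> inj S \<longrightarrow>
            (\<exists>Q\<in>BH. \<exists>A\<in>BH. positive_on UNIV Q \<and>
               (elem_delta (adj A) A ^^ m) Q = (\<lambda>_. 0) \<and>
               elem_delta A (S ^^ n) P = (\<lambda>_. 0)))
       \<and> (left_invertible S \<longrightarrow>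
            (\<exists>B\<in>BH. (d (adj B) B ^^ m) id = (\<lambda>_. 0) \<and> similar (S ^^ n) B))"
proof (intro conjI impI; (elim conjE)?)
  note S = \<open>S \<in> BH\<close> and n = \<open>n \<ge> 1\<close>
  note transport = transported_defect_zero[OF assms(4,5,6)]
  have Sn: "S ^^ n \<in> BH" and Sn_adj: "adj S ^^ n \<in> BH"
    by (intro BH_funpow BH_adj S)+
  define G where "G = (adj S ^^ n) \<circ> (S ^^ n)"
  have G_BH: "G \<in> BH" unfolding G_def by (intro BH_comp Sn Sn_adj)
  have G_inner: "inner x (G y) = inner ((S ^^ n) x) ((S ^^ n) y)" for x y
    by (simp add: G_def adj_funpow_inner[OF S])
  have gram_pos: "positive_on UNIV Q" if "Q \<in> BH" "\<And>x y. inner x (Q y) = inner (W x) (W y)"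
    for Q W :: "'a \<Rightarrow> 'a"
    unfolding positive_on_UNIV_iff positive_operator_def
    using that(1) by (auto simp: that(2) BH_bounded_linear) (metis inner_commute that(2))
  have G_pos: "positive_on UNIV G" by (rule gram_pos[OF G_BH G_inner])
  {
    assume d: "d = elem_tri"
    have "(d (adj (S ^^ n)) (S ^^ n) ^^ m) G = (\<lambda>_. 0)"
      by (rule transport[OF BH_id _ _ Sn _ G_BH]) (simp_all add: G_def)
    moreover have "similar (S ^^ n) (S ^^ n)"
      unfolding similar_def by (intro bexI[of _ id] BH_id) auto
    ultimately show "\<exists>Q\<in>BH. \<exists>A\<in>BH. positive_on UNIV Q \<and>
        (elem_tri (adj A) A ^^ m) Q = (\<lambda>_. 0) \<and> similar (S ^^ n) A"
      using G_pos G_BH Sn unfolding d by blast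
  next
    assume d: "d = elem_delta" and inj: "inj S"
    define \<pi> where "\<pi> = orth_proj (range_closure n S)"
    note P_BH = polar_sum_properties(1)[OF S n, folded \<open>P = polar_sum n S\<close>]
      and P_sym = polar_sum_properties(2)[OF S n, folded \<open>P = polar_sum n S\<close>]
      and P_norm = polar_sum_properties(3)[OF S n, folded \<open>P = polar_sum n S\<close> \<pi>_def]
    have Sn_lin: "linear (S ^^ n)" using Sn by (simp add: BH_iff bounded_linear.linear)
    have P_inj: "x = 0" if "P x = 0" for x
    proof -
      have "(norm ((S ^^ n) (\<pi> x)))\<^sup>2 + (norm (x - \<pi> x))\<^sup>2 = 0"
        unfolding P_norm[symmetric] by (simp add: that)
      then have "(S ^^ n) (\<pi> x) = 0 \<and> x = \<pi> x"
        unfolding sum_power2_eq_zero_iff norm_eq_zero right_minus_eq .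
      then show "x = 0"
        using inj_fn[OF inj, of n] linear_0[OF Sn_lin] by (metis injD)
    qed
    obtain K where K: "K \<ge> 0" "\<forall>x\<in>UNIV. norm ((S ^^ n) x) \<le> K * norm x"
      using bounded_operators_bound[OF Sn] by blast
    have dom: "norm ((S ^^ n) x) \<le> (1 + K) * norm (P x)" for x
    proof -
      \<comment> \<open>\<open>P x\<close> dominates the image of \<open>\<pi> x\<close> under \<open>S\<^sup>n\<close>, but the component \<open>x - \<pi> x\<close> itself.\<close>
      have "norm ((S ^^ n) (\<pi> x)) \<le> norm (P x)" "norm (x - \<pi> x) \<le> norm (P x)"
        by (rule power2_le_imp_le; simp add: P_norm)+
      moreover have "norm ((S ^^ n) (x - \<pi> x)) \<le> K * norm (x - \<pi> x)" using K by blast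
      moreover have "norm ((S ^^ n) x) \<le> norm ((S ^^ n) (\<pi> x)) + norm ((S ^^ n) (x - \<pi> x))"
        using norm_triangle_ineq[of "(S ^^ n) (\<pi> x)" "(S ^^ n) (x - \<pi> x)"]
        by (simp add: linear_diff[OF Sn_lin])
      ultimately show ?thesis
        using mult_left_mono[of "norm (x - \<pi> x)" "norm (P x)" K] K(1)
        by (simp add: algebra_simps)
    qed
    obtain W where W: "W \<in> BH" "\<And>x. W (P x) = (S ^^ n) x"
      using factor_through_dense_range[OF P_BH self_adjoint_dense_range[OF P_BH P_sym P_inj] Sn dom]
      by blast
    define A where "A = P \<circ> W"
    define Q where "Q = adj W \<circ> W"
    have A_BH: "A \<in> BH" and Q_BH: "Q \<in> BH"
      unfolding A_def Q_def by (intro BH_comp BH_adj P_BH W)+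
    have Q_inner: "inner x (Q y) = inner (W x) (W y)" for x y
      by (simp add: Q_def BH_adj(2)[OF W(1)])
    have "P (Q (P x)) = (adj S ^^ n) ((S ^^ n) x)" for x
    proof (rule vector_eq_ldot[THEN iffD1, rule_format])
      fix y
      have "inner y (P (Q (P x))) = inner ((S ^^ n) y) ((S ^^ n) x)"
        by (simp add: Q_inner W(2) flip: P_sym)
      also have "\<dots> = inner y ((adj S ^^ n) ((S ^^ n) x))"
        by (rule adj_funpow_inner[OF S])
      finally show "inner y (P (Q (P x))) = inner y ((adj S ^^ n) ((S ^^ n) x))" .
    qed
    then have "(d (adj A) A ^^ m) Q = (\<lambda>_. 0)"
      by (intro transport[OF P_BH P_sym P_inj A_BH _ Q_BH]) (simp_all add: A_def W(2))
    moreover have "elem_delta A (S ^^ n) P = (\<lambda>_. 0)"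
      by (simp add: elem_delta_def A_def W(2))
    moreover have "positive_on UNIV Q" by (rule gram_pos[OF Q_BH Q_inner])
    ultimately show "\<exists>Q\<in>BH. \<exists>A\<in>BH. positive_on UNIV Q \<and>
        (elem_delta (adj A) A ^^ m) Q = (\<lambda>_. 0) \<and> elem_delta A (S ^^ n) P = (\<lambda>_. 0)"
      using A_BH Q_BH unfolding d by blast
  next
    assume "left_invertible S"
    then obtain L where L: "L \<in> BH" "L \<circ> S = id" unfolding left_invertible_def by blast
    have LS: "(L ^^ k) ((S ^^ k) x) = x" for k x
      using L(2) by (induction k) (simp_all add: funpow_swap1[of L] fun_eq_iff)
    obtain K where K: "K \<ge> 0" "\<forall>x\<in>UNIV. norm ((L ^^ n) x) \<le> K * norm x"
      using bounded_operators_bound[OF BH_funpow[OF L(1)]] by blast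
    define R where "R = sqrt_on UNIV G"
    note R = sqrt_on_exists[OF complex_vector.subspace_UNIV closed_UNIV G_pos, folded R_def]
    have R_BH: "R \<in> BH" and R_sym: "inner (R x) y = inner x (R y)" for x y
      using R(1) by (simp_all add: positive_on_UNIV_iff positive_operator_def)
    have RR: "R (R x) = G x" for x using R(2) by (simp add: fun_eq_iff)
    have "norm (R x) = norm ((S ^^ n) x)" for x
      by (simp add: norm_eq_sqrt_inner R_sym RR G_inner)
    then have below: "norm (id x) \<le> K * norm (R x)" for x
      using bspec[OF K(2) UNIV_I, of "(S ^^ n) x"] by (simp add: LS)
    have R_inj: "x = 0" if "R x = 0" for x
      using below[of x] that by simp
    note dense = self_adjoint_dense_range[OF R_BH R_sym R_inj]
    obtain W where W: "W \<in> BH" "\<And>x. W (R x) = id x"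
      using factor_through_dense_range[OF R_BH dense BH_id below] by blast
    have RW: "R (W y) = y" for y
    proof -
      have "closed {y. R (W y) = y}"
        using BH_comp[OF R_BH W(1)]
        by (intro closed_Collect_eq continuous_on_id) (simp add: BH_iff linear_continuous_on o_def)
      then have "closure (range R) \<subseteq> {y. R (W y) = y}"
        using W(2) by (intro closure_minimal) auto
      then show ?thesis by (auto simp: dense)
    qed
    define B where "B = R \<circ> (S ^^ n) \<circ> W"
    have B_BH: "B \<in> BH" unfolding B_def by (intro BH_comp R_BH Sn W)
    have "(d (adj B) B ^^ m) id = (\<lambda>_. 0)"
      by (rule transport[OF R_BH R_sym R_inj B_BH _ BH_id])
        (simp_all add: B_def W(2) RR, simp add: G_def)
    moreover have "similar (S ^^ n) B"
      unfolding similar_def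
      by (intro bexI[of _ R] bexI[of _ W] conjI R_BH W) (auto simp: fun_eq_iff RW W(2) B_def)
    ultimately show "\<exists>B\<in>BH. (d (adj B) B ^^ m) id = (\<lambda>_. 0) \<and> similar (S ^^ n) B"
      using B_BH by blast
  }
qed

end
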